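(* Let $\mathcal{C}\subset\mathbb{R}^3$ be a rational space curve, neither a line nor a circle, with a proper rational parametrization $\boldsymbol{x}(t)=(x(t),y(t),z(t))$ with rational coefficients, and fix a sign $\pm$. Let $G^{\pm}_{\boldsymbol{x}}(t,s)$ be the bivariate polynomial attached to $\boldsymbol{x}$ and the sign $\pm$ as defined in the context. Then the following are equivalent: (i) $\mathcal{C}$ has a nontrivial symmetry $f(\boldsymbol{p})=\boldsymbol{Q}\boldsymbol{p}+\boldsymbol{b}$ with $\det(\boldsymbol{Q})=\pm 1$ (same sign), i.e. there is an isometry $f$ of $\mathbb{R}^3$, different from the identity, of this form with $f(\mathcal{C})=\mathcal{C}$; (ii) there exists a nontrivial polynomial $F(t,s)=(ct+d)s-(at+b)$, with $a,b,c,d\in\mathbb{R}$ and $ad-bc\neq 0$, associated with the M\"obius transformation $\varphi(t)=\frac{at+b}{ct+d}$, such that $F$ divides $G^{\pm}_{\boldsymbol{x}}$ and the parametrizations $\boldsymbol{x}$ and $\boldsymbol{x}\circ\varphi$ have identical speed, $\|\boldsymbol{x}'\|=\|(\boldsymbol{x}\circ\varphi)'\|$.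
   Context: A rational space curve $\mathcal{C}\subset\mathbb{R}^3$ is an irreducible algebraic curve parametrized by a rational map $\boldsymbol{x}:\mathbb{R}\dashrightarrow\mathcal{C}$, $\boldsymbol{x}(t)=(x(t),y(t),z(t))$, whose components are rational functions with rational coefficients ($\mathcal{C}$ is the Zariski closure in $\mathbb{R}^3$ of the image). The parametrization is proper if it is birational, equivalently injective except for perhaps finitely many values of $t$. An isometry of $\mathbb{R}^3$ is a map $f(\boldsymbol{p})=\boldsymbol{Q}\boldsymbol{p}+\boldsymbol{b}$ with $\boldsymbol{Q}\in\mathbb{R}^{3\times3}$ orthogonal and $\boldsymbol{b}\in\mathbb{R}^3$. Curvature and torsion are $$\kappa_{\boldsymbol{x}}=\frac{\|\boldsymbol{x}'\times\boldsymbol{x}''\|}{\|\boldsymbol{x}'\|^3},\qquad \tau_{\boldsymbol{x}}=\frac{\langle\boldsymbol{x}'\times\boldsymbol{x}'',\boldsymbol{x}'''\rangle}{\|\boldsymbol{x}'\times\boldsymbol{x}''\|^2}.$$ The functions $\kappa_{\boldsymbol{x}}^2$ and $\tau_{\boldsymbol{x}}$ are rational; write $\kappa_{\boldsymbol{x}}^2(t)=A(t)/B(t)$ and $\tau_{\boldsymbol{x}}(t)=C(t)/D(t)$ with $(A,B)$ and $(C,D)$ pairs of coprime polynomials. Define $$K_{\boldsymbol{x}}(t,s)=A(t)B(s)-A(s)B(t),\qquad T^{\pm}_{\boldsymbol{x}}(t,s)=C(t)D(s)\mp C(s)D(t),\qquad G^{\pm}_{\boldsymbol{x}}=\gcd(K_{\boldsymbol{x}},T^{\pm}_{\boldsymbol{x}}),$$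 with linked signs: the upper sign throughout corresponds to $\det(\boldsymbol{Q})=+1$ and the lower sign to $\det(\boldsymbol{Q})=-1$. Here $\gcd(K,0)=K$. The polynomial $F(t,s)=(ct+d)s-(at+b)$, $ad-bc\ne0$, is called trivial when the associated M\"obius transformation $\varphi(t)=(at+b)/(ct+d)$ is the identity (i.e. $F=s-t$ up to a constant factor), and nontrivial otherwise. The equality of speeds is an identity of functions of $t$, wherever both sides are defined.
   Formalization: For a plane curve with the lower sign, reflection in its plane makes (i) always true while (ii) can fail, e.g. (t, t^4+t^3, 0); there "different from the identity" is replaced by "moves some point of the curve", an equivalence proved for all curves and both signs. *)

theory Defs
  imports
    "HOL-Analysis.Analysis"
    "HOL-Computational_Algebra.Computational_Algebra"
    "HOL-Computational_Algebra.Field_as_Ring"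
begin

unbundle cross3_syntax

text \<open>An element of \<open>\<rat>(t)\<close> has type \<open>rat poly fract\<close>; \<open>quot_of_fract\<close> returns its fraction in
  lowest terms, so the zeros of \<open>rf_den r\<close> are exactly the poles of \<open>r\<close>.\<close>

definition rf_num :: "rat poly fract \<Rightarrow> real poly" where
  "rf_num r = map_poly of_rat (fst (quot_of_fract r))"

definition rf_den :: "rat poly fract \<Rightarrow> real poly" where
  "rf_den r = map_poly of_rat (snd (quot_of_fract r))"

definition rf_dom :: "(rat poly fract) ^ 3 \<Rightarrow> real set" where
  "rf_dom x = {t. \<forall>i. poly (rf_den (x $ i)) t \<noteq> 0}"

definition rf_map :: "(rat poly fract) ^ 3 \<Rightarrow> real \<Rightarrow> real ^ 3" where
  "rf_map x t = (\<chi> i. poly (rf_num (x $ i)) t / poly (rf_den (x $ i)) t)"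

definition zariski_closure :: "(real ^ 3) set \<Rightarrow> (real ^ 3) set" where
  "zariski_closure S =
     {p. \<forall>g. real_polynomial_function g \<and> (\<forall>q\<in>S. g q = 0) \<longrightarrow> g p = 0}"

definition curve :: "(rat poly fract) ^ 3 \<Rightarrow> (real ^ 3) set" where
  "curve x = zariski_closure (rf_map x ` rf_dom x)"

text \<open>Birationality: a rational function \<open>g / h\<close> on the curve is inverse to the parametrization,
  where identities of rational maps hold off finite subsets of the line and of the curve
  (the proper Zariski closed subsets). Injectivity on a cofinite set of \<^emph>\<open>real\<close> parameters
  would be too weak: it holds for \<open>t \<mapsto> (t\<^sup>3, t\<^sup>6, 0)\<close>, which is not birational.\<close>

definition proper_parametrization :: "(rat poly fract) ^ 3 \<Rightarrow> bool" where
  "proper_parametrization x \<longleftrightarrow>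
     (\<exists>g h. real_polynomial_function g \<and> real_polynomial_function h \<and>
        finite {t \<in> rf_dom x. \<not> (h (rf_map x t) \<noteq> 0 \<and> g (rf_map x t) / h (rf_map x t) = t)} \<and>
        finite {p \<in> curve x. \<not> (h p \<noteq> 0 \<and> g p / h p \<in> rf_dom x \<and> rf_map x (g p / h p) = p)})"

definition is_line :: "(real ^ 3) set \<Rightarrow> bool" where
  "is_line S \<longleftrightarrow> (\<exists>p v. v \<noteq> 0 \<and> S = range (\<lambda>u. p + u *\<^sub>R v))"

definition is_circle :: "(real ^ 3) set \<Rightarrow> bool" where
  "is_circle S \<longleftrightarrow>
     (\<exists>m n r. n \<noteq> 0 \<and> r > 0 \<and> S = {p. norm (p - m) = r \<and> n \<bullet> (p - m) = 0})"

definition vderiv :: "(real \<Rightarrow> real ^ 3) \<Rightarrow> real \<Rightarrow> real ^ 3" where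
  "vderiv y t = vector_derivative y (at t)"

definition speed :: "(real \<Rightarrow> real ^ 3) \<Rightarrow> real \<Rightarrow> real" where
  "speed y t = norm (vderiv y t)"

definition curvature :: "(real \<Rightarrow> real ^ 3) \<Rightarrow> real \<Rightarrow> real" where
  "curvature y t = norm (vderiv y t \<times> vderiv (vderiv y) t) / norm (vderiv y t) ^ 3"

definition torsion :: "(real \<Rightarrow> real ^ 3) \<Rightarrow> real \<Rightarrow> real" where
  "torsion y t = (vderiv y t \<times> vderiv (vderiv y) t) \<bullet> vderiv (vderiv (vderiv y)) t
                 / norm (vderiv y t \<times> vderiv (vderiv y) t) ^ 2"

definition curvature_dom :: "(rat poly fract) ^ 3 \<Rightarrow> real set" where
  "curvature_dom x = {t \<in> rf_dom x. vderiv (rf_map x) t \<noteq> 0}"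

definition torsion_dom :: "(rat poly fract) ^ 3 \<Rightarrow> real set" where
  "torsion_dom x =
     {t \<in> rf_dom x. vderiv (rf_map x) t \<times> vderiv (vderiv (rf_map x)) t \<noteq> 0}"

definition is_reduced_fraction ::
    "real poly \<Rightarrow> real poly \<Rightarrow> (real \<Rightarrow> real) \<Rightarrow> real set \<Rightarrow> bool" where
  "is_reduced_fraction P Q g S \<longleftrightarrow> Q \<noteq> 0 \<and> coprime P Q \<and>
     (\<forall>t\<in>S. poly Q t \<noteq> 0 \<longrightarrow> g t = poly P t / poly Q t)"

text \<open>A polynomial in \<open>t\<close> and \<open>s\<close> is a polynomial in \<open>s\<close> (outer variable) with coefficients in
  \<open>\<real>[t]\<close>. Its value at \<open>(t, s)\<close> is \<open>poly (poly P [:s:]) t\<close>.\<close>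

definition in_t :: "real poly \<Rightarrow> real poly poly" where
  "in_t P = [:P:]"

definition in_s :: "real poly \<Rightarrow> real poly poly" where
  "in_s P = map_poly (\<lambda>c. [:c:]) P"

definition K_poly :: "real poly \<Rightarrow> real poly \<Rightarrow> real poly poly" where
  "K_poly A B = in_t A * in_s B - in_s A * in_t B"

text \<open>The sign \<open>\<plusminus>\<close> is a real \<open>\<sigma> = \<plusminus> 1\<close>, so that the linked sign \<open>\<minusplus>\<close> is \<open>- \<sigma>\<close>.\<close>

definition T_poly :: "real \<Rightarrow> real poly \<Rightarrow> real poly \<Rightarrow> real poly poly" where
  "T_poly \<sigma> C D = in_t C * in_s D - in_t [:\<sigma>:] * in_s C * in_t D"

definition G_poly ::
    "real \<Rightarrow> real poly \<Rightarrow> real poly \<Rightarrow> real poly \<Rightarrow> real poly \<Rightarrow> real poly poly" where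
  "G_poly \<sigma> A B C D = gcd (K_poly A B) (T_poly \<sigma> C D)"

definition moebius :: "real \<Rightarrow> real \<Rightarrow> real \<Rightarrow> real \<Rightarrow> real \<Rightarrow> real" where
  "moebius a b c d t = (a * t + b) / (c * t + d)"

text \<open>\<open>(c t + d) s - (a t + b)\<close>\<close>

definition F_poly :: "real \<Rightarrow> real \<Rightarrow> real \<Rightarrow> real \<Rightarrow> real poly poly" where
  "F_poly a b c d = in_t [:d, c:] * in_s [:0, 1:] - in_t [:b, a:]"

definition nontrivial_moebius :: "real \<Rightarrow> real \<Rightarrow> real \<Rightarrow> real \<Rightarrow> bool" where
  "nontrivial_moebius a b c d \<longleftrightarrow> (\<exists>t. c * t + d \<noteq> 0 \<and> moebius a b c d t \<noteq> t)"

definition same_speed :: "(rat poly fract) ^ 3 \<Rightarrow> real \<Rightarrow> real \<Rightarrow> real \<Rightarrow> real \<Rightarrow> bool" where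
  "same_speed x a b c d \<longleftrightarrow>
     (\<forall>t. t \<in> rf_dom x \<and> c * t + d \<noteq> 0 \<and> moebius a b c d t \<in> rf_dom x \<longrightarrow>
        speed (rf_map x) t = speed (rf_map x \<circ> moebius a b c d) t)"

definition moebius_criterion :: "(rat poly fract) ^ 3 \<Rightarrow> real poly poly \<Rightarrow> bool" where
  "moebius_criterion x G \<longleftrightarrow>
     (\<exists>a b c d. a * d - b * c \<noteq> 0 \<and> nontrivial_moebius a b c d \<and>
        F_poly a b c d dvd G \<and> same_speed x a b c d)"

text \<open>If \<open>S\<close> lies in a plane, the reflection in that plane is a symmetry with \<open>\<sigma> = - 1\<close> that is
  different from \<open>id\<close> but fixes \<open>S\<close> pointwise; as a change of parameter it is the identity. For curves
  other than lines this is the only case where \<open>f \<noteq> id\<close> does not imply \<open>\<exists>p\<in>S. f p \<noteq> p\<close>.\<close>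

definition is_symmetry :: "real \<Rightarrow> (real ^ 3) set \<Rightarrow> (real ^ 3 \<Rightarrow> real ^ 3) \<Rightarrow> bool" where
  "is_symmetry \<sigma> S f \<longleftrightarrow>
     (\<exists>Q b. orthogonal_matrix Q \<and> det Q = \<sigma> \<and> f = (\<lambda>p. Q *v p + b)) \<and> f ` S = S"

end

theory Submission
  imports Defs
begin

text \<open>
  Why the theorem holds. Since \<open>x\<close> is birational onto the curve, an isometry \<open>f\<close> that maps the
  curve into itself can be pulled back to the parameter line: there is a rational \<open>\<phi>\<close> with
  \<open>x \<circ> \<phi> = f \<circ> x\<close>, and pulling back the inverse isometry gives a rational left inverse of \<open>\<phi>\<close>. A rational
  function with a rational left inverse has degree one, so \<open>\<phi>\<close> is a Moebius transformation
  (\<open>left_invertible_rational_is_moebius\<close>, \<open>symmetry_induces_moebius\<close>). Curvature does not change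
  under reparametrization or isometries; torsion does not change under reparametrization and is
  multiplied by \<open>det Q = \<sigma>\<close> by the isometry. Hence \<open>\<kappa>\<^sup>2(t) = \<kappa>\<^sup>2(\<phi>(t))\<close> and \<open>\<tau>(t) = \<sigma> \<tau>(\<phi>(t))\<close>, that is,
  the polynomials \<open>K\<close> and \<open>T\<close> vanish on the graph of \<open>\<phi>\<close>, and this means that the
  polynomial \<open>F\<close> of \<open>\<phi>\<close> divides both of them (\<open>F_poly_dvdI\<close>). The speeds agree because \<open>f\<close> preserves lengths.

  Conversely, if \<open>F\<close> divides \<open>G\<close> and the speeds agree, then on some interval \<open>x \<circ> \<phi>\<close> and \<open>x\<close> have the
  same speed and curvature, and torsions that agree up to the factor \<open>\<sigma>\<close>. The uniqueness half of the
  fundamental theorem of space curves (\<open>rigid_motion_of_equal_invariants\<close>) yields an isometry \<open>f\<close> with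
  determinant \<open>\<sigma>\<close> and \<open>x \<circ> \<phi> = f \<circ> x\<close> on that interval. Both sides are rational, so the equation holds
  wherever it is defined, and \<open>f\<close> preserves the Zariski closure of the image
  (\<open>affine_map_preserves_curve\<close>).

  The map \<open>\<phi>\<close> is the identity iff \<open>f\<close> fixes the curve pointwise. As the curve is not a line, it has a
  point where the velocity and the acceleration span a plane; an isometry that fixes the curve
  pointwise also fixes these two vectors, so it is the identity or the reflection in that plane, and in
  the second case the curve lies in the plane (\<open>rigid_motion_fixing_curve\<close>).
\<close>

no_notation fps_nth (infixl \<open>$\<close> 75)

section \<open>Rational functions and curves on a set of parameters\<close>

text \<open>The denominator must not vanish anywhere on \<open>S\<close>. The predicate is closed under
  arithmetic, composition and differentiation, so it provides derivatives of every order, and two such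
  functions that agree at infinitely many points of \<open>S\<close> agree on \<open>S\<close> (\<open>rational_on_eqI\<close>), even if \<open>S\<close> is
  not connected. It thus takes the place both of smoothness and of Zariski density.\<close>

definition rational_on :: "real set \<Rightarrow> (real \<Rightarrow> real) \<Rightarrow> bool" where
  "rational_on S f \<longleftrightarrow> (\<exists>P Q. \<forall>t\<in>S. poly Q t \<noteq> 0 \<and> f t = poly P t / poly Q t)"

lemma rational_onI:
  "(\<And>t. t \<in> S \<Longrightarrow> poly Q t \<noteq> 0 \<and> f t = poly P t / poly Q t) \<Longrightarrow> rational_on S f"
  unfolding rational_on_def by blast

lemma rational_on_subset: "rational_on S f \<Longrightarrow> T \<subseteq> S \<Longrightarrow> rational_on T f"
  unfolding rational_on_def by blast

lemma rational_on_cong: "rational_on S f \<Longrightarrow> (\<And>t. t \<in> S \<Longrightarrow> g t = f t) \<Longrightarrow> rational_on S g"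
  unfolding rational_on_def by auto

lemma rational_on_const: "rational_on S (\<lambda>t. c)"
  by (rule rational_onI[of _ 1 _ "[:c:]"]) simp

lemma rational_on_ident: "rational_on S (\<lambda>t. t)"
  by (rule rational_onI[of _ 1 _ "[:0, 1:]"]) simp

lemma rational_on_add:
  assumes "rational_on S f" "rational_on S g"
  shows "rational_on S (\<lambda>t. f t + g t)"
proof -
  obtain P Q where f: "\<And>t. t \<in> S \<Longrightarrow> poly Q t \<noteq> 0 \<and> f t = poly P t / poly Q t"
    using assms(1) unfolding rational_on_def by blast
  obtain R W where g: "\<And>t. t \<in> S \<Longrightarrow> poly W t \<noteq> 0 \<and> g t = poly R t / poly W t"
    using assms(2) unfolding rational_on_def by blast
  show ?thesis
    by (rule rational_onI[of _ "Q * W" _ "P * W + R * Q"])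
       (use f g in \<open>auto simp: add_frac_eq\<close>)
qed

lemma rational_on_mult:
  assumes "rational_on S f" "rational_on S g"
  shows "rational_on S (\<lambda>t. f t * g t)"
proof -
  obtain P Q where f: "\<And>t. t \<in> S \<Longrightarrow> poly Q t \<noteq> 0 \<and> f t = poly P t / poly Q t"
    using assms(1) unfolding rational_on_def by blast
  obtain R W where g: "\<And>t. t \<in> S \<Longrightarrow> poly W t \<noteq> 0 \<and> g t = poly R t / poly W t"
    using assms(2) unfolding rational_on_def by blast
  show ?thesis
    by (rule rational_onI[of _ "Q * W" _ "P * R"]) (use f g in auto)
qed

lemma rational_on_inverse:
  assumes "rational_on S f" "\<And>t. t \<in> S \<Longrightarrow> f t \<noteq> 0"
  shows "rational_on S (\<lambda>t. inverse (f t))"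
proof -
  obtain P Q where f: "\<And>t. t \<in> S \<Longrightarrow> poly Q t \<noteq> 0 \<and> f t = poly P t / poly Q t"
    using assms(1) unfolding rational_on_def by blast
  have "poly P t \<noteq> 0" if "t \<in> S" for t
    using f[OF that] assms(2)[OF that] by auto
  then show ?thesis
    by (intro rational_onI[of _ P _ Q]) (use f in auto)
qed

lemma rational_on_divide:
  assumes "rational_on S f" "rational_on S g" "\<And>t. t \<in> S \<Longrightarrow> g t \<noteq> 0"
  shows "rational_on S (\<lambda>t. f t / g t)"
  using rational_on_mult[OF assms(1) rational_on_inverse[OF assms(2,3)]]
  by (simp add: divide_inverse)

lemma rational_on_diff:
  assumes "rational_on S f" "rational_on S g"
  shows "rational_on S (\<lambda>t. f t - g t)"
  using rational_on_add[OF assms(1) rational_on_mult[OF rational_on_const[of S "-1"] assms(2)]]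
  by simp

lemma rational_on_sum:
  assumes "finite I" "\<And>i. i \<in> I \<Longrightarrow> rational_on S (f i)"
  shows "rational_on S (\<lambda>t. \<Sum>i\<in>I. f i t)"
  using assms by (induction I) (simp_all add: rational_on_const rational_on_add)

lemma rational_on_poly:
  assumes "rational_on S f"
  shows "rational_on S (\<lambda>t. poly P (f t))"
proof (induction P)
  case 0
  show ?case by (simp add: rational_on_const)
next
  case (pCons c P)
  have "rational_on S (\<lambda>t. c + f t * poly P (f t))"
    by (intro rational_on_add rational_on_const rational_on_mult assms pCons.IH)
  then show ?case by simp
qed

lemma rational_on_compose:
  assumes "rational_on T f" "rational_on S \<phi>" "\<And>t. t \<in> S \<Longrightarrow> \<phi> t \<in> T"
  shows "rational_on S (\<lambda>t. f (\<phi> t))"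
proof -
  obtain P Q where f: "\<And>t. t \<in> T \<Longrightarrow> poly Q t \<noteq> 0 \<and> f t = poly P t / poly Q t"
    using assms(1) unfolding rational_on_def by blast
  have "rational_on S (\<lambda>t. poly P (\<phi> t) / poly Q (\<phi> t))"
    by (intro rational_on_divide rational_on_poly assms(2)) (use f[OF assms(3)] in auto)
  then show ?thesis
    by (rule rational_on_cong) (use f[OF assms(3)] in auto)
qed

lemma rational_on_moebius:
  "(\<And>t. t \<in> S \<Longrightarrow> c * t + d \<noteq> 0) \<Longrightarrow> rational_on S (moebius a b c d)"
  by (rule rational_onI[of _ "[:d, c:]" _ "[:b, a:]"]) (simp add: moebius_def algebra_simps)

lemma rational_on_deriv:
  assumes f: "rational_on S f" and S: "open S"
  shows "t \<in> S \<Longrightarrow> (f has_field_derivative deriv f t) (at t)"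
    and "rational_on S (deriv f)"
proof -
  obtain P Q where PQ: "\<And>t. t \<in> S \<Longrightarrow> poly Q t \<noteq> 0 \<and> f t = poly P t / poly Q t"
    using f unfolding rational_on_def by blast
  have D: "(f has_field_derivative
      poly (pderiv P * Q - P * pderiv Q) t / poly (Q * Q) t) (at t)" if t: "t \<in> S" for t
  proof (rule has_field_derivative_transform_within_open[OF _ S t])
    show "((\<lambda>t. poly P t / poly Q t) has_field_derivative
        poly (pderiv P * Q - P * pderiv Q) t / poly (Q * Q) t) (at t)"
      using PQ[OF t] by (auto intro!: derivative_eq_intros simp: poly_DERIV)
  qed (use PQ in auto)
  show "(f has_field_derivative deriv f t) (at t)" if "t \<in> S"
    using D[OF that] by (metis DERIV_imp_deriv)
  show "rational_on S (deriv f)"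
    by (rule rational_onI[of _ "Q * Q" _ "pderiv P * Q - P * pderiv Q"])
       (use PQ DERIV_imp_deriv[OF D] in auto)
qed

text \<open>The identity principle: the numerator of the difference has infinitely many roots.\<close>

lemma rational_on_eqI:
  assumes f: "rational_on S f" and g: "rational_on S g"
    and inf: "infinite {t\<in>S. f t = g t}" and t: "t \<in> S"
  shows "f t = g t"
proof -
  obtain P Q where PQ: "\<And>t. t \<in> S \<Longrightarrow> poly Q t \<noteq> 0 \<and> f t - g t = poly P t / poly Q t"
    using rational_on_diff[OF f g] unfolding rational_on_def by blast
  have "{t\<in>S. f t = g t} \<subseteq> {t. poly P t = 0}"
    using PQ by (auto simp del: divide_eq_0_iff) fastforce
  then have "P = 0"
    using inf poly_roots_finite finite_subset by blast
  then show ?thesis using PQ[OF t] by simp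
qed

lemma rational_on_reduced:
  assumes "rational_on S f" "S \<noteq> {}"
  obtains P Q where "coprime P Q" "\<forall>t\<in>S. poly Q t \<noteq> 0 \<and> f t = poly P t / poly Q t"
proof -
  obtain P Q where PQ: "\<And>t. t \<in> S \<Longrightarrow> poly Q t \<noteq> 0 \<and> f t = poly P t / poly Q t"
    using assms(1) unfolding rational_on_def by blast
  have Q: "Q \<noteq> 0" using PQ assms(2) by force
  then obtain P' Q' where P': "P = P' * gcd P Q" "Q = Q' * gcd P Q" "coprime P' Q'"
    by (metis gcd_coprime_exists gcd_eq_0_iff)
  have eq: "poly P t = poly P' t * poly (gcd P Q) t"  "poly Q t = poly Q' t * poly (gcd P Q) t" for t
    using P'(1,2) by (metis poly_mult)+
  show ?thesis
    by (rule that[OF P'(3)]) (use PQ eq in auto)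
qed

definition rational_curve :: "real set \<Rightarrow> (real \<Rightarrow> real ^ 3) \<Rightarrow> bool" where
  "rational_curve S y \<longleftrightarrow> (\<forall>i. rational_on S (\<lambda>t. y t $ i))"

lemma rational_curve_subset: "rational_curve S y \<Longrightarrow> T \<subseteq> S \<Longrightarrow> rational_curve T y"
  unfolding rational_curve_def using rational_on_subset by blast

lemma rational_curve_eqI:
  assumes "rational_curve S y" "rational_curve S z"
    and "infinite {t\<in>S. y t = z t}" "t \<in> S"
  shows "y t = z t"
proof (rule vec_eq_iff[THEN iffD2], rule allI)
  fix i
  have "infinite {t\<in>S. y t $ i = z t $ i}"
    by (rule infinite_super[OF _ assms(3)]) auto
  then show "y t $ i = z t $ i"
    using rational_on_eqI assms unfolding rational_curve_def by blast
qed

lemma rational_curve_compose: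
  assumes "rational_curve T y" "rational_on S \<phi>" "\<And>t. t \<in> S \<Longrightarrow> \<phi> t \<in> T"
  shows "rational_curve S (\<lambda>t. y (\<phi> t))"
  using assms rational_on_compose[of T "\<lambda>t. y t $ _" S \<phi>] unfolding rational_curve_def by blast

lemma rational_curve_scaleR:
  "rational_on S f \<Longrightarrow> rational_curve S y \<Longrightarrow> rational_curve S (\<lambda>t. f t *\<^sub>R y t)"
  unfolding rational_curve_def by (simp add: rational_on_mult)

lemma rational_curve_add:
  "rational_curve S y \<Longrightarrow> rational_curve S z \<Longrightarrow> rational_curve S (\<lambda>t. y t + z t)"
  unfolding rational_curve_def by (simp add: rational_on_add)

lemma rational_curve_const: "rational_curve S (\<lambda>t. p)"
  unfolding rational_curve_def by (simp add: rational_on_const)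

lemma rational_curve_affine:
  assumes "rational_curve S y"
  shows "rational_curve S (\<lambda>t. Q *v y t + b)"
  using assms unfolding rational_curve_def matrix_vector_mult_def
  by (auto intro!: rational_on_add rational_on_sum rational_on_mult rational_on_const)

text \<open>Equations of the curve become rational equations in the parameter. This is how statements about
  the Zariski closure are reduced to the identity principle.\<close>

lemma rational_on_real_polynomial_function:
  assumes "real_polynomial_function g" and y: "rational_curve S y"
  shows "rational_on S (\<lambda>t. g (y t))"
  using assms(1)
proof (induction g)
  case (linear h)
  have "h (y t) = (\<Sum>i\<in>UNIV. y t $ i * h (axis i 1))" for t
  proof -
    have "h (y t) = h (\<Sum>i\<in>UNIV. y t $ i *\<^sub>R axis i 1)"
      using basis_expansion[of "y t"] by (simp add: scalar_mult_eq_scaleR)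
    also have "\<dots> = (\<Sum>i\<in>UNIV. y t $ i * h (axis i 1))"
      using linear by (simp add: linear_sum linear_scale bounded_linear.linear)
    finally show ?thesis .
  qed
  then show ?case
    using y unfolding rational_curve_def
    by (auto intro!: rational_on_sum rational_on_mult rational_on_const)
qed (auto intro: rational_on_const rational_on_add rational_on_mult)

lemma vderiv_eqI: "(y has_vector_derivative v) (at t) \<Longrightarrow> vderiv y t = v"
  unfolding vderiv_def by (rule vector_derivative_at)

lemma rational_curve_vderiv:
  assumes y: "rational_curve S y" and S: "open S"
  shows "t \<in> S \<Longrightarrow> (y has_vector_derivative vderiv y t) (at t)"
    and "rational_curve S (vderiv y)"
proof -
  have D: "(y has_vector_derivative (\<chi> i. deriv (\<lambda>t. y t $ i) t)) (at t)" if "t \<in> S" for t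
  proof -
    have "((\<lambda>t. y t $ i) has_field_derivative deriv (\<lambda>t. y t $ i) t) (at t)" for i
      using rational_on_deriv(1)[OF _ S that] y unfolding rational_curve_def by blast
    then have "((\<lambda>t. \<chi> i. y t $ i) has_vector_derivative (\<chi> i. deriv (\<lambda>t. y t $ i) t)) (at t)"
      unfolding has_vector_derivative_def has_field_derivative_def
      by (subst has_derivative_componentwise_within)
         (auto simp: Basis_vec_def inner_axis mult.commute[of _ "deriv _ _"])
    then show ?thesis by simp
  qed
  show "(y has_vector_derivative vderiv y t) (at t)" if "t \<in> S"
    using D[OF that] vderiv_eqI by metis
  have "vderiv y t $ i = deriv (\<lambda>t. y t $ i) t" if "t \<in> S" for t i
    using vderiv_eqI[OF D[OF that]] by simp
  moreover have "rational_on S (deriv (\<lambda>t. y t $ i))" for i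
    using rational_on_deriv(2)[OF _ S] y unfolding rational_curve_def by blast
  ultimately show "rational_curve S (vderiv y)"
    unfolding rational_curve_def by (auto intro: rational_on_cong)
qed

lemma rational_curve_continuous:
  "rational_curve S y \<Longrightarrow> open S \<Longrightarrow> continuous_on S y"
  by (auto intro!: continuous_at_imp_continuous_on has_vector_derivative_continuous
      dest: rational_curve_vderiv(1))

lemma vderiv_cong:
  assumes "open S" "\<And>t. t \<in> S \<Longrightarrow> y t = z t" "t \<in> S"
  shows "vderiv y t = vderiv z t"
  unfolding vderiv_def
  using assms by (intro vector_derivative_cong_eq) (auto simp: eventually_nhds)

section \<open>Curvature and torsion under reparametrization and rigid motions\<close>

lemma bounded_bilinear_cross3: "bounded_bilinear (\<times>)"
  using bilinear_cross bilinear_conv_bounded_bilinear by blast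

lemmas has_vector_derivative_cross3 =
  bounded_bilinear.has_vector_derivative[OF bounded_bilinear_cross3]

lemmas has_vector_derivative_inner =
  bounded_bilinear.has_vector_derivative[OF bounded_bilinear_inner]

lemma vderiv_compose:
  assumes "rational_curve T y" "open T" "rational_on S \<phi>" "open S" "t \<in> S" "\<phi> t \<in> T"
  shows "((\<lambda>t. y (\<phi> t)) has_vector_derivative deriv \<phi> t *\<^sub>R vderiv y (\<phi> t)) (at t)"
proof -
  have "(\<phi> has_vector_derivative deriv \<phi> t) (at t)"
    using rational_on_deriv(1) assms has_real_derivative_iff_has_vector_derivative by blast
  from vector_diff_chain_at[OF this rational_curve_vderiv(1)[OF assms(1,2,6)]]
  show ?thesis by (simp add: o_def)
qed

text \<open>Only the leading coefficient of the third derivative matters, because the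
  triple product that defines the torsion kills the multiples of the first two derivatives.\<close>

lemma reparametrized_derivatives:
  assumes x: "rational_curve T x" "open T" and phi: "rational_on S \<phi>" "open S"
    and maps: "\<phi> ` S \<subseteq> T" and t: "t \<in> S"
  shows "vderiv (\<lambda>t. x (\<phi> t)) t = deriv \<phi> t *\<^sub>R vderiv x (\<phi> t)"
    and "vderiv (vderiv (\<lambda>t. x (\<phi> t))) t =
           deriv (deriv \<phi>) t *\<^sub>R vderiv x (\<phi> t) + (deriv \<phi> t)\<^sup>2 *\<^sub>R vderiv (vderiv x) (\<phi> t)"
    and "\<exists>c d. vderiv (vderiv (vderiv (\<lambda>t. x (\<phi> t)))) t =
           c *\<^sub>R vderiv x (\<phi> t) + d *\<^sub>R vderiv (vderiv x) (\<phi> t)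
           + (deriv \<phi> t)^3 *\<^sub>R vderiv (vderiv (vderiv x)) (\<phi> t)"
proof -
  note x1 = rational_curve_vderiv(2)[OF x]
  note x2 = rational_curve_vderiv(2)[OF x1 x(2)]
  note phi1 = rational_on_deriv(2)[OF phi]
  note phi2 = rational_on_deriv(2)[OF phi1 phi(2)]
  have v1: "vderiv (\<lambda>t. x (\<phi> t)) t = deriv \<phi> t *\<^sub>R vderiv x (\<phi> t)" if "t \<in> S" for t
    by (intro vderiv_eqI vderiv_compose[OF x phi]) (use maps that in auto)
  have v2: "vderiv (vderiv (\<lambda>t. x (\<phi> t))) t =
      deriv (deriv \<phi>) t *\<^sub>R vderiv x (\<phi> t) + (deriv \<phi> t)\<^sup>2 *\<^sub>R vderiv (vderiv x) (\<phi> t)"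
    if t: "t \<in> S" for t
  proof -
    have "((\<lambda>t. deriv \<phi> t *\<^sub>R vderiv x (\<phi> t)) has_vector_derivative
        deriv \<phi> t *\<^sub>R deriv \<phi> t *\<^sub>R vderiv (vderiv x) (\<phi> t)
        + deriv (deriv \<phi>) t *\<^sub>R vderiv x (\<phi> t)) (at t)"
      by (intro has_vector_derivative_scaleR rational_on_deriv(1)[OF phi1 phi(2) t]
          vderiv_compose[OF x1 x(2) phi t]) (use maps t in auto)
    from vderiv_eqI[OF this] show ?thesis
      using vderiv_cong[OF phi(2) v1 t] by (simp add: power2_eq_square)
  qed
  show "vderiv (\<lambda>t. x (\<phi> t)) t = deriv \<phi> t *\<^sub>R vderiv x (\<phi> t)"
    using v1 t .
  show "vderiv (vderiv (\<lambda>t. x (\<phi> t))) t =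
      deriv (deriv \<phi>) t *\<^sub>R vderiv x (\<phi> t) + (deriv \<phi> t)\<^sup>2 *\<^sub>R vderiv (vderiv x) (\<phi> t)"
    using v2 t .
  have "((\<lambda>t. deriv (deriv \<phi>) t *\<^sub>R vderiv x (\<phi> t)
        + (deriv \<phi> t)\<^sup>2 *\<^sub>R vderiv (vderiv x) (\<phi> t)) has_vector_derivative
      (deriv (deriv \<phi>) t *\<^sub>R deriv \<phi> t *\<^sub>R vderiv (vderiv x) (\<phi> t)
        + deriv (deriv (deriv \<phi>)) t *\<^sub>R vderiv x (\<phi> t))
      + ((deriv \<phi> t)\<^sup>2 *\<^sub>R deriv \<phi> t *\<^sub>R vderiv (vderiv (vderiv x)) (\<phi> t)
        + (2 * deriv \<phi> t * deriv (deriv \<phi>) t) *\<^sub>R vderiv (vderiv x) (\<phi> t))) (at t)"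
    using rational_on_deriv(1)[OF phi1 phi(2) t] maps t
    by (intro has_vector_derivative_add has_vector_derivative_scaleR
          rational_on_deriv(1)[OF phi2 phi(2) t] vderiv_compose[OF x1 x(2) phi t]
          vderiv_compose[OF x2 x(2) phi t])
       (auto intro!: derivative_eq_intros)
  from vderiv_eqI[OF this]
  have "vderiv (vderiv (vderiv (\<lambda>t. x (\<phi> t)))) t =
      deriv (deriv (deriv \<phi>)) t *\<^sub>R vderiv x (\<phi> t)
      + (3 * deriv \<phi> t * deriv (deriv \<phi>) t) *\<^sub>R vderiv (vderiv x) (\<phi> t)
      + (deriv \<phi> t)^3 *\<^sub>R vderiv (vderiv (vderiv x)) (\<phi> t)"
    using vderiv_cong[OF phi(2) v2 t]
    by (simp add: power2_eq_square power3_eq_cube algebra_simps flip: scaleR_left_distrib)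
  then show "\<exists>c d. vderiv (vderiv (vderiv (\<lambda>t. x (\<phi> t)))) t =
      c *\<^sub>R vderiv x (\<phi> t) + d *\<^sub>R vderiv (vderiv x) (\<phi> t)
      + (deriv \<phi> t)^3 *\<^sub>R vderiv (vderiv (vderiv x)) (\<phi> t)"
    by blast
qed

text \<open>Numerators and denominators scale by the same power of \<open>\<phi>'\<close>: up to sign by
  \<open>(\<phi>')\<^sup>3\<close> for the curvature, where the absolute values hide the orientation, and by \<open>(\<phi>')\<^sup>6\<close>, which is
  positive, for the torsion.\<close>

lemma
  assumes x: "rational_curve T x" "open T" and phi: "rational_on S \<phi>" "open S"
    and maps: "\<phi> ` S \<subseteq> T" and t: "t \<in> S" and nz: "deriv \<phi> t \<noteq> 0"
  shows curvature_reparametrized: "curvature (\<lambda>t. x (\<phi> t)) t = curvature x (\<phi> t)"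
    and torsion_reparametrized: "torsion (\<lambda>t. x (\<phi> t)) t = torsion x (\<phi> t)"
proof -
  define k where "k = deriv \<phi> t"
  note D = reparametrized_derivatives[OF x phi maps t, folded k_def]
  have cross: "vderiv (\<lambda>t. x (\<phi> t)) t \<times> vderiv (vderiv (\<lambda>t. x (\<phi> t))) t =
      k^3 *\<^sub>R (vderiv x (\<phi> t) \<times> vderiv (vderiv x) (\<phi> t))"
    by (simp add: D(1,2) cross_add_right cross_mult_left cross_mult_right
        power2_eq_square power3_eq_cube)
  have norm3: "norm (vderiv (\<lambda>t. x (\<phi> t)) t) ^ 3 = \<bar>k\<bar>^3 * norm (vderiv x (\<phi> t)) ^ 3"
    unfolding D(1) by (simp add: power_mult_distrib)
  show "curvature (\<lambda>t. x (\<phi> t)) t = curvature x (\<phi> t)"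
    unfolding curvature_def cross norm3 using nz by (simp add: k_def power_abs)
  have triple: "(vderiv (\<lambda>t. x (\<phi> t)) t \<times> vderiv (vderiv (\<lambda>t. x (\<phi> t))) t)
      \<bullet> vderiv (vderiv (vderiv (\<lambda>t. x (\<phi> t)))) t =
      k^6 * ((vderiv x (\<phi> t) \<times> vderiv (vderiv x) (\<phi> t)) \<bullet> vderiv (vderiv (vderiv x)) (\<phi> t))"
    unfolding cross using D(3)
    by (auto simp: inner_add_right dot_cross_self simp flip: power_add)
  have norm2: "norm (vderiv (\<lambda>t. x (\<phi> t)) t \<times> vderiv (vderiv (\<lambda>t. x (\<phi> t))) t) ^ 2 =
      k^6 * norm (vderiv x (\<phi> t) \<times> vderiv (vderiv x) (\<phi> t)) ^ 2"
    unfolding cross by (simp add: power_mult_distrib power_abs flip: power_mult)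
  show "torsion (\<lambda>t. x (\<phi> t)) t = torsion x (\<phi> t)"
    unfolding torsion_def norm2 triple using nz by (simp add: k_def)
qed

lemma inner_orthogonal_matrix_mult:
  "orthogonal_matrix Q \<Longrightarrow> (Q *v p) \<bullet> (Q *v q) = p \<bullet> (q :: real ^ 'n)"
  using orthogonal_transformation_matrix[of "(*v) Q"]
  by (simp add: orthogonal_transformation_def)

lemma norm_orthogonal_matrix_mult:
  "orthogonal_matrix Q \<Longrightarrow> norm (Q *v p) = norm (p :: real ^ 'n)"
  by (simp add: norm_eq inner_orthogonal_matrix_mult)

lemma vderiv_affine:
  assumes "(y has_vector_derivative y') (at t)"
  shows "vderiv (\<lambda>t. Q *v y t + b) t = Q *v y'"
  using bounded_linear.has_vector_derivative[OF matrix_vector_mul_bounded_linear assms, of Q]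
  by (intro vderiv_eqI) (auto intro!: derivative_eq_intros)

text \<open>The determinant enters the torsion through \<open>Qu \<times> Qv = det Q \<cdot> Q (u \<times> v)\<close>.\<close>

lemma
  assumes y: "rational_curve S y" "open S" and Q: "orthogonal_matrix Q" and t: "t \<in> S"
  shows speed_rigid_motion: "speed (\<lambda>t. Q *v y t + b) t = speed y t"
    and curvature_rigid_motion: "curvature (\<lambda>t. Q *v y t + b) t = curvature y t"
    and torsion_rigid_motion: "torsion (\<lambda>t. Q *v y t + b) t = det Q * torsion y t"
proof -
  note y1 = rational_curve_vderiv(2)[OF y]
  note y2 = rational_curve_vderiv(2)[OF y1 y(2)]
  have v1: "vderiv (\<lambda>t. Q *v y t + b) t = Q *v vderiv y t" if "t \<in> S" for t
    by (rule vderiv_affine[OF rational_curve_vderiv(1)[OF y that]])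
  have v2: "vderiv (vderiv (\<lambda>t. Q *v y t + b)) t = Q *v vderiv (vderiv y) t" if "t \<in> S" for t
    using vderiv_cong[OF y(2) v1 that]
      vderiv_affine[OF rational_curve_vderiv(1)[OF y1 y(2) that], of Q 0] by simp
  have v3: "vderiv (vderiv (vderiv (\<lambda>t. Q *v y t + b))) t = Q *v vderiv (vderiv (vderiv y)) t"
    using vderiv_cong[OF y(2) v2 t]
      vderiv_affine[OF rational_curve_vderiv(1)[OF y2 y(2) t], of Q 0] by simp
  show "speed (\<lambda>t. Q *v y t + b) t = speed y t"
    by (simp add: speed_def v1[OF t] norm_orthogonal_matrix_mult[OF Q])
  have det: "\<bar>det Q\<bar> = 1"
    using det_orthogonal_matrix[OF Q] by auto
  have cross: "norm (det Q *\<^sub>R (Q *v p)) = norm p" for p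
    by (simp add: det norm_orthogonal_matrix_mult[OF Q])
  show "curvature (\<lambda>t. Q *v y t + b) t = curvature y t"
    unfolding curvature_def v1[OF t] v2[OF t] cross_orthogonal_matrix[OF Q] cross
    by (simp add: norm_orthogonal_matrix_mult[OF Q])
  show "torsion (\<lambda>t. Q *v y t + b) t = det Q * torsion y t"
    unfolding torsion_def v1[OF t] v2[OF t] v3 cross_orthogonal_matrix[OF Q] cross
    by (simp add: inner_orthogonal_matrix_mult[OF Q])
qed

section \<open>Rigidity of space curves\<close>

text \<open>The Frenet frame consists of tangent, normal and binormal. It is orthonormal as soon as
  \<open>y' \<times> y'' \<noteq> 0\<close>.\<close>

definition tangent :: "(real \<Rightarrow> real ^ 3) \<Rightarrow> real \<Rightarrow> real ^ 3" where
  "tangent y t = sgn (vderiv y t)"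

definition binormal :: "(real \<Rightarrow> real ^ 3) \<Rightarrow> real \<Rightarrow> real ^ 3" where
  "binormal y t = sgn (vderiv y t \<times> vderiv (vderiv y) t)"

definition normal :: "(real \<Rightarrow> real ^ 3) \<Rightarrow> real \<Rightarrow> real ^ 3" where
  "normal y t = binormal y t \<times> tangent y t"

text \<open>A unit vector field moves orthogonally to itself, so normalizing projects the derivative onto the
  orthogonal complement.\<close>

lemma has_vector_derivative_sgn:
  fixes f :: "real \<Rightarrow> 'a::real_inner"
  assumes f: "(f has_vector_derivative f') (at t)" and nz: "f t \<noteq> 0"
  shows "((\<lambda>t. sgn (f t)) has_vector_derivative
           (f' - (sgn (f t) \<bullet> f') *\<^sub>R sgn (f t)) /\<^sub>R norm (f t)) (at t)"
proof -
  have "((\<lambda>t. norm (f t)) has_derivative (\<lambda>h. (h *\<^sub>R f') \<bullet> sgn (f t))) (at t)"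
    using has_derivative_compose[OF f[unfolded has_vector_derivative_def] has_derivative_norm[OF nz]]
    by simp
  then have n: "((\<lambda>t. norm (f t)) has_field_derivative sgn (f t) \<bullet> f') (at t)"
    unfolding has_field_derivative_def by (simp add: inner_commute mult_commute_abs)
  have "((\<lambda>t. inverse (norm (f t)) *\<^sub>R f t) has_vector_derivative
      inverse (norm (f t)) *\<^sub>R f'
      + (- (inverse (norm (f t)) * (sgn (f t) \<bullet> f') * inverse (norm (f t)))) *\<^sub>R f t) (at t)"
    using nz by (intro has_vector_derivative_scaleR DERIV_inverse' n f) auto
  then show ?thesis
    by (simp add: sgn_div_norm scaleR_diff_right mult.assoc)
qed

text \<open>In the expansion, the part \<open>r\<close> of a vector that is orthogonal to \<open>T\<close> and \<open>B\<close> is parallel to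
  \<open>B \<times> T\<close>, because Lagrange's identity gives \<open>r \<times> (B \<times> T) = 0\<close>.\<close>

lemma
  fixes T B :: "real ^ 3"
  assumes TB: "norm T = 1" "norm B = 1" "T \<bullet> B = 0"
  shows orthonormal_frame_cross: "B \<times> (B \<times> T) = - T" "(B \<times> T) \<times> T = - B"
    and orthonormal_frame_inner: "(B \<times> T) \<bullet> T = 0" "(B \<times> T) \<bullet> B = 0" "(B \<times> T) \<bullet> (B \<times> T) = 1"
    and orthonormal_frame_expansion:
      "(T \<bullet> p) *\<^sub>R T + ((B \<times> T) \<bullet> p) *\<^sub>R (B \<times> T) + (B \<bullet> p) *\<^sub>R B = p"
proof -
  have i: "T \<bullet> T = 1" "B \<bullet> B = 1" "B \<bullet> T = 0"
    using TB by (simp_all add: dot_square_norm inner_commute)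
  show c: "B \<times> (B \<times> T) = - T"
    using i Lagrange[of B B T] by simp
  have "T \<times> (B \<times> T) = B"
    using i Lagrange[of T B T] TB(3) by simp
  then show "(B \<times> T) \<times> T = - B"
    using cross_skew by metis
  show n: "(B \<times> T) \<bullet> T = 0" "(B \<times> T) \<bullet> B = 0"
    by (simp_all add: dot_cross_self)
  have "(norm (B \<times> T))\<^sup>2 = 1"
    using norm_cross_dot[of B T] TB i by simp
  then show N: "(B \<times> T) \<bullet> (B \<times> T) = 1"
    by (simp add: dot_square_norm)
  define r where "r = p - (T \<bullet> p) *\<^sub>R T - (B \<bullet> p) *\<^sub>R B"
  have r: "r \<bullet> T = 0" "r \<bullet> B = 0" "(B \<times> T) \<bullet> r = (B \<times> T) \<bullet> p"
    using i TB(3) n by (simp_all add: r_def inner_diff_left inner_diff_right inner_commute)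
  have "r \<times> (B \<times> T) = 0"
    using r by (simp add: Lagrange)
  moreover have "(B \<times> T) \<times> (r \<times> (B \<times> T)) = r - ((B \<times> T) \<bullet> p) *\<^sub>R (B \<times> T)"
    using r(3) N Lagrange[of "B \<times> T" r "B \<times> T"] by simp
  ultimately have "r = ((B \<times> T) \<bullet> p) *\<^sub>R (B \<times> T)"
    by simp
  then show "(T \<bullet> p) *\<^sub>R T + ((B \<times> T) \<bullet> p) *\<^sub>R (B \<times> T) + (B \<bullet> p) *\<^sub>R B = p"
    by (simp add: r_def algebra_simps)
qed

lemma
  assumes "vderiv y t \<times> vderiv (vderiv y) t \<noteq> 0"
  shows norm_tangent: "norm (tangent y t) = 1"
    and norm_binormal: "norm (binormal y t) = 1"
    and tangent_binormal: "tangent y t \<bullet> binormal y t = 0"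
proof -
  have "vderiv y t \<noteq> 0" using assms by auto
  then show "norm (tangent y t) = 1" "norm (binormal y t) = 1"
    using assms by (simp_all add: tangent_def binormal_def norm_sgn)
  show "tangent y t \<bullet> binormal y t = 0"
    by (simp add: tangent_def binormal_def sgn_div_norm dot_cross_self)
qed

text \<open>The derivative of the tangent and that of the binormal are scaled projections of \<open>y''\<close> and of
  \<open>(y' \<times> y'')'\<close> (\<open>has_vector_derivative_sgn\<close>); each is a multiple of the normal. The derivative of the normal then follows from the product rule.\<close>

lemma frenet_serret:
  assumes y1: "(vderiv y has_vector_derivative vderiv (vderiv y) t) (at t)"
    and y2: "(vderiv (vderiv y) has_vector_derivative vderiv (vderiv (vderiv y)) t) (at t)"
    and nz: "vderiv y t \<times> vderiv (vderiv y) t \<noteq> 0"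
  defines "k \<equiv> speed y t * curvature y t" and "w \<equiv> speed y t * torsion y t"
  shows "(tangent y has_vector_derivative k *\<^sub>R normal y t) (at t)"
    and "(normal y has_vector_derivative w *\<^sub>R binormal y t - k *\<^sub>R tangent y t) (at t)"
    and "(binormal y has_vector_derivative - w *\<^sub>R normal y t) (at t)"
proof -
  define u b v where "u = vderiv y t" and "b = vderiv y t \<times> vderiv (vderiv y) t"
    and "v = norm (vderiv y t)"
  have u: "u \<noteq> 0" and v: "v > 0" using nz by (auto simp: u_def v_def)
  have b: "b \<noteq> 0" using nz by (simp add: b_def)
  let ?T = "tangent y t" and ?N = "normal y t" and ?B = "binormal y t"
  have uT: "u = v *\<^sub>R ?T" using v by (simp add: u_def v_def tangent_def sgn_div_norm)
  have bB: "b = norm b *\<^sub>R ?B" using b by (simp add: b_def binormal_def sgn_div_norm)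
  note frame = norm_tangent[OF nz] norm_binormal[OF nz] tangent_binormal[OF nz]
  have N: "?N = ?B \<times> ?T" by (simp add: normal_def)
  note expand = orthonormal_frame_expansion[OF frame, folded N]
  note inner = orthonormal_frame_inner[OF frame, folded N]
  have k: "k = norm b / v\<^sup>2"
    using v by (simp add: k_def speed_def curvature_def b_def v_def power2_eq_square power3_eq_cube)
  have w: "w = v * (b \<bullet> vderiv (vderiv (vderiv y)) t) / (norm b)\<^sup>2"
    by (simp add: w_def speed_def torsion_def b_def v_def)

  let ?p = "vderiv (vderiv y) t"
  have "?B \<bullet> ?p = 0"
    using nz by (simp add: binormal_def sgn_div_norm dot_cross_self)
  moreover have "?N \<bullet> ?p = norm b / v"
  proof -
    have "?N \<bullet> (v *\<^sub>R ?p) = ?B \<bullet> (u \<times> ?p)"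
      by (simp add: N uT cross_triple cross_mult_left inner_commute)
         (metis cross_triple inner_commute)
    also have "\<dots> = norm b"
      using bB frame(2) by (metis b_def u_def inner_scaleR_right mult.right_neutral norm_eq_1)
    finally show ?thesis using v by (simp add: field_simps)
  qed
  ultimately have p: "?p - (?T \<bullet> ?p) *\<^sub>R ?T = (norm b / v) *\<^sub>R ?N"
    using expand[of ?p] by (simp add: algebra_simps)
  have "(tangent y has_vector_derivative (?p - (?T \<bullet> ?p) *\<^sub>R ?T) /\<^sub>R v) (at t)"
    using has_vector_derivative_sgn[OF y1] u unfolding tangent_def u_def v_def by blast
  then show T': "(tangent y has_vector_derivative k *\<^sub>R ?N) (at t)"
    unfolding p k by (simp add: power2_eq_square field_simps)

  let ?q = "vderiv y t \<times> vderiv (vderiv (vderiv y)) t"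
  have b': "((\<lambda>t. vderiv y t \<times> vderiv (vderiv y) t) has_vector_derivative ?q) (at t)"
    using has_vector_derivative_cross3[OF y1 y2] by simp
  have "?T \<bullet> ?q = 0"
    by (simp add: tangent_def sgn_div_norm dot_cross_self)
  moreover have "?N \<bullet> ?q = - (w * norm b)"
  proof -
    have "?N \<bullet> ?q = - v * (?B \<bullet> vderiv (vderiv (vderiv y)) t)"
    proof -
      have "?N \<times> vderiv y t = - v *\<^sub>R ?B"
        using uT orthonormal_frame_cross(2)[OF frame, folded N]
        by (simp add: u_def cross_mult_right)
      then show ?thesis
        by (simp add: inner_commute[of ?N] flip: cross_triple)
    qed
    also have "\<dots> = - (w * norm b)"
    proof -
      have "b \<bullet> vderiv (vderiv (vderiv y)) t = norm b * (?B \<bullet> vderiv (vderiv (vderiv y)) t)"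
        using bB by (metis inner_scaleR_left)
      then show ?thesis using b by (simp add: w power2_eq_square)
    qed
    finally show ?thesis .
  qed
  ultimately have q: "?q - (?B \<bullet> ?q) *\<^sub>R ?B = - (w * norm b) *\<^sub>R ?N"
    using expand[of ?q] by (simp add: algebra_simps)
  have "(binormal y has_vector_derivative (?q - (?B \<bullet> ?q) *\<^sub>R ?B) /\<^sub>R norm b) (at t)"
    using has_vector_derivative_sgn[OF b' nz] unfolding binormal_def b_def .
  then show B': "(binormal y has_vector_derivative - w *\<^sub>R ?N) (at t)"
    unfolding q using b by (simp add: mult.commute[of w] flip: mult.assoc)
  have "(normal y has_vector_derivative ?B \<times> (k *\<^sub>R ?N) + (- w *\<^sub>R ?N) \<times> ?T) (at t)"
    unfolding normal_def[abs_def] using has_vector_derivative_cross3[OF B' T'] by (simp add: normal_def)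
  moreover have "?B \<times> (k *\<^sub>R ?N) + (- w *\<^sub>R ?N) \<times> ?T = w *\<^sub>R ?B - k *\<^sub>R ?T"
    using orthonormal_frame_cross[OF frame, folded N] by (simp add: cross_mult_left cross_mult_right)
  ultimately show "(normal y has_vector_derivative w *\<^sub>R ?B - k *\<^sub>R ?T) (at t)"
    by simp
qed

lemma constant_of_zero_derivative:
  fixes f :: "real \<Rightarrow> 'a::real_normed_vector"
  assumes "convex S" "\<And>t. t \<in> S \<Longrightarrow> (f has_vector_derivative 0) (at t)"
  shows "\<exists>c. \<forall>t\<in>S. f t = c"
  by (rule has_vector_derivative_zero_constant[OF assms(1)
        has_vector_derivative_at_within[OF assms(2)]]) blast+

lemma has_vector_derivative_rank_one:
  fixes f g :: "real \<Rightarrow> 'a::real_inner"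
  assumes f: "(f has_vector_derivative f') (at t)" and g: "(g has_vector_derivative g') (at t)"
  shows "((\<lambda>t. (f t \<bullet> p) *\<^sub>R g t) has_vector_derivative
           (f t \<bullet> p) *\<^sub>R g' + (f' \<bullet> p) *\<^sub>R g t) (at t)"
proof -
  have "((\<lambda>t. f t \<bullet> p) has_field_derivative f' \<bullet> p) (at t)"
    using has_vector_derivative_inner[OF f has_vector_derivative_const[of p]]
    by (simp add: has_real_derivative_iff_has_vector_derivative)
  then show ?thesis
    by (rule has_vector_derivative_scaleR[OF _ g])
qed

text \<open>Uniqueness in the fundamental theorem of space curves. Let \<open>M t\<close> be the linear map that takes the
  Frenet frame of \<open>y\<close> at \<open>t\<close> to that of \<open>z\<close>. Both frames satisfy the same Frenet-Serret equations, whose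
  coefficient matrix is skew-symmetric, so the terms of the derivative of \<open>M\<close> cancel in pairs and \<open>M\<close> is a
  constant rotation. It takes \<open>y'\<close> to \<open>z'\<close> because the speeds agree, and integrating gives the
  translation.\<close>

lemma rigid_motion_of_equal_invariants:
  assumes S: "open S" "convex S" "S \<noteq> {}"
    and y: "rational_curve S y" and z: "rational_curve S z"
    and nz: "\<And>t. t \<in> S \<Longrightarrow> vderiv y t \<times> vderiv (vderiv y) t \<noteq> 0"
    and speed: "\<And>t. t \<in> S \<Longrightarrow> speed z t = speed y t"
    and curvature: "\<And>t. t \<in> S \<Longrightarrow> curvature z t = curvature y t"
    and torsion: "\<And>t. t \<in> S \<Longrightarrow> torsion z t = torsion y t"
  obtains Q b where "orthogonal_matrix Q" "det Q = 1" "\<forall>t\<in>S. z t = Q *v y t + b"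
proof -
  note y1 = rational_curve_vderiv(2)[OF y S(1)] and z1 = rational_curve_vderiv(2)[OF z S(1)]
  note y2 = rational_curve_vderiv(2)[OF y1 S(1)] and z2 = rational_curve_vderiv(2)[OF z1 S(1)]
  have nz': "vderiv z t \<times> vderiv (vderiv z) t \<noteq> 0" if t: "t \<in> S" for t
  proof -
    have "vderiv y t \<noteq> 0" using nz[OF t] by auto
    then have "curvature z t \<noteq> 0"
      using nz[OF t] curvature[OF t] by (simp add: curvature_def)
    then show ?thesis by (auto simp: curvature_def)
  qed
  \<comment> \<open>\<open>M t = T\<^sub>z T\<^sub>y\<^sup>T + N\<^sub>z N\<^sub>y\<^sup>T + B\<^sub>z B\<^sub>y\<^sup>T\<close>, applied to \<open>p\<close>\<close>
  define M where "M t p = (tangent y t \<bullet> p) *\<^sub>R tangent z t + (normal y t \<bullet> p) *\<^sub>R normal z t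
    + (binormal y t \<bullet> p) *\<^sub>R binormal z t" for t p
  have M': "((\<lambda>t. M t p) has_vector_derivative 0) (at t)" if t: "t \<in> S" for t p
  proof -
    define k w where "k = speed y t * curvature y t" and "w = speed y t * torsion y t"
    note Dy = frenet_serret[OF rational_curve_vderiv(1)[OF y1 S(1) t]
        rational_curve_vderiv(1)[OF y2 S(1) t] nz[OF t], folded k_def w_def]
    note Dz = frenet_serret[OF rational_curve_vderiv(1)[OF z1 S(1) t]
        rational_curve_vderiv(1)[OF z2 S(1) t] nz'[OF t],
        unfolded speed[OF t] curvature[OF t] torsion[OF t], folded k_def w_def]
    have "((\<lambda>t. M t p) has_vector_derivative
        ((tangent y t \<bullet> p) *\<^sub>R (k *\<^sub>R normal z t) + ((k *\<^sub>R normal y t) \<bullet> p) *\<^sub>R tangent z t)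
        + ((normal y t \<bullet> p) *\<^sub>R (w *\<^sub>R binormal z t - k *\<^sub>R tangent z t)
          + ((w *\<^sub>R binormal y t - k *\<^sub>R tangent y t) \<bullet> p) *\<^sub>R normal z t)
        + ((binormal y t \<bullet> p) *\<^sub>R (- w *\<^sub>R normal z t)
          + ((- w *\<^sub>R normal y t) \<bullet> p) *\<^sub>R binormal z t)) (at t)"
      (is "(_ has_vector_derivative ?d) _")
      unfolding M_def
      by (intro has_vector_derivative_add has_vector_derivative_rank_one Dy Dz)
    moreover have "?d = 0"
      by (simp add: inner_diff_left algebra_simps)
    ultimately show ?thesis by simp
  qed
  obtain t0 where t0: "t0 \<in> S" using S(3) by blast
  define m where "m = M t0"
  have m: "M t p = m p" if t: "t \<in> S" for t p
    using constant_of_zero_derivative[OF S(2), of "\<lambda>t. M t p"] M' t t0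
    unfolding m_def by metis
  note frame_y = norm_tangent[OF nz] norm_binormal[OF nz] tangent_binormal[OF nz]
  note frame_z = norm_tangent[OF nz'] norm_binormal[OF nz'] tangent_binormal[OF nz']
  have m_frame: "m (tangent y t) = tangent z t" "m (normal y t) = normal z t"
      "m (binormal y t) = binormal z t" if t: "t \<in> S" for t
    using frame_y[OF t] orthonormal_frame_inner[OF frame_y[OF t], folded normal_def]
    by (simp_all add: M_def inner_commute dot_square_norm flip: m[OF t])
  have "linear m"
    unfolding m_def M_def
    by (rule linearI) (simp_all add: inner_add_right algebra_simps)
  have "norm (m p) = norm p" for p
  proof -
    have parseval: "v \<bullet> v = a\<^sup>2 + b\<^sup>2 + c\<^sup>2"
      if fr: "norm (tangent x t0) = 1" "norm (binormal x t0) = 1" "tangent x t0 \<bullet> binormal x t0 = 0"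
        and v: "v = a *\<^sub>R tangent x t0 + b *\<^sub>R normal x t0 + c *\<^sub>R binormal x t0"
      for a b c and v and x
      using fr(3) fr(1,2)[unfolded norm_eq_1]
        orthonormal_frame_inner[OF fr, folded normal_def]
      by (simp add: v inner_add_left inner_add_right inner_commute power2_eq_square)
    show ?thesis
      unfolding norm_eq
      using parseval[OF frame_z[OF t0] M_def[of t0 p]] parseval[OF frame_y[OF t0]
        orthonormal_frame_expansion[OF frame_y[OF t0], folded normal_def, symmetric]]
      by (simp add: m_def)
  qed
  then have "orthogonal_transformation m"
    using \<open>linear m\<close> by (simp add: orthogonal_transformation)
  then have Q: "orthogonal_matrix (matrix m)"
    using orthogonal_transformation_matrix by blast
  have Qm: "matrix m *v p = m p" for p
    using \<open>linear m\<close> by (simp add: matrix_works)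
  have det: "det (matrix m) = 1"
  proof -
    \<comment> \<open>apply \<open>m\<close> to \<open>B \<times> T = N\<close>\<close>
    have "normal z t0 = det (matrix m) *\<^sub>R normal z t0"
      using cross_orthogonal_matrix[OF Q, of "binormal y t0" "tangent y t0"] m_frame[OF t0]
      by (simp add: Qm flip: normal_def)
    moreover have "normal z t0 \<noteq> 0"
      using orthonormal_frame_inner(3)[OF frame_z[OF t0], folded normal_def] by auto
    ultimately show ?thesis
      by (metis scaleR_cancel_right scaleR_one)
  qed
  have "((\<lambda>t. z t - matrix m *v y t) has_vector_derivative 0) (at t)" if t: "t \<in> S" for t
  proof -
    have "matrix m *v vderiv y t = vderiv z t"
    proof -
      have "vderiv y t \<noteq> 0" "vderiv z t \<noteq> 0"
        using nz[OF t] nz'[OF t] by auto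
      then have "vderiv y t = speed y t *\<^sub>R tangent y t" "vderiv z t = speed y t *\<^sub>R tangent z t"
        using speed[OF t] by (simp_all add: speed_def tangent_def sgn_div_norm)
      then show ?thesis
        using m_frame[OF t] by (simp add: matrix_vector_mult_scaleR Qm)
    qed
    then show ?thesis
      using has_vector_derivative_diff[OF rational_curve_vderiv(1)[OF z S(1) t]
          bounded_linear.has_vector_derivative[OF matrix_vector_mul_bounded_linear
            rational_curve_vderiv(1)[OF y S(1) t], of "matrix m"]] by simp
  qed
  then obtain b where "\<And>t. t \<in> S \<Longrightarrow> z t - matrix m *v y t = b"
    using constant_of_zero_derivative[OF S(2), of "\<lambda>t. z t - matrix m *v y t"] by blast
  then show ?thesis
    by (intro that[OF Q det, of b]) (simp add: algebra_simps)
qed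

section \<open>Moebius transformations and their polynomials\<close>

lemma poly_in_t [simp]: "poly (poly (in_t P) [:s:]) t = poly P t"
  by (simp add: in_t_def)

lemma poly_in_s [simp]: "poly (poly (in_s P) [:s:]) t = poly P s"
proof -
  have "poly (in_s P) [:s:] = [:poly P s:]"
    unfolding in_s_def by (induction P) (simp_all add: map_poly_pCons)
  then show ?thesis by simp
qed

lemma poly_K_poly:
  "poly (poly (K_poly A B) [:s:]) t = poly A t * poly B s - poly A s * poly B t"
  by (simp add: K_poly_def)

lemma poly_T_poly:
  "poly (poly (T_poly \<sigma> C D) [:s:]) t = poly C t * poly D s - \<sigma> * poly C s * poly D t"
  by (simp add: T_poly_def)

lemma F_poly_eq: "F_poly a b c d = [:- [:b, a:], [:d, c:]:]"
  by (simp add: F_poly_def in_t_def in_s_def map_poly_pCons)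

lemma F_poly_root:
  "c * t + d \<noteq> 0 \<Longrightarrow> poly (poly (F_poly a b c d) [:moebius a b c d t:]) t = 0"
  by (simp add: F_poly_eq moebius_def field_simps)

text \<open>Put \<open>L = c t + d\<close> and \<open>N = a t + b\<close>, so that \<open>F = L s - N\<close>. From \<open>L H = F q\<close> it follows that \<open>L\<close> divides
  \<open>N q\<close>, and as \<open>a L - c N\<close> is the nonzero constant \<open>a d - b c\<close>, \<open>L\<close> divides \<open>q\<close>. The argument
  covers a constant \<open>L\<close> as well.\<close>

lemma F_poly_dvd_cancel:
  assumes det: "a * d - b * c \<noteq> 0" and dvd: "F_poly a b c d dvd smult ([:d, c:] ^ n) H"
  shows "F_poly a b c d dvd H"
  using dvd
proof (induction n)
  case (Suc n)
  define L N where "L = [:d, c:]" and "N = [:b, a:]"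
  define H' where "H' = smult (L ^ n) H"
  have F: "F_poly a b c d = [:0, 1:] * [:L:] - [:N:]"
    by (simp add: F_poly_eq L_def N_def)
  obtain q where q: "[:L:] * H' = F_poly a b c d * q"
    using Suc.prems by (auto simp: L_def H'_def elim!: dvdE)
  have "[:N:] * q = [:L:] * ([:0, 1:] * q - H')"
    using q unfolding F by (simp add: algebra_simps)
  then have "[:L:] dvd [:[:c:]:] * ([:N:] * q)"
    by (metis dvd_mult dvd_triv_left)
  moreover have "[:L:] dvd [:[:a:]:] * ([:L:] * q)"
    by (intro dvd_mult dvd_triv_left)
  ultimately have "[:L:] dvd [:[:a:]:] * ([:L:] * q) - [:[:c:]:] * ([:N:] * q)"
    by (rule dvd_diff[rotated])
  moreover have "[:[:a:]:] * ([:L:] * q) - [:[:c:]:] * ([:N:] * q) = [:[:a * d - b * c:]:] * q"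
  proof -
    have "[:[:a:]:] * [:L:] - [:[:c:]:] * [:N:] = [:[:a * d - b * c:]:]"
      by (simp add: L_def N_def algebra_simps)
    then show ?thesis
      by (metis left_diff_distrib mult.assoc)
  qed
  moreover have "is_unit [:[:a * d - b * c:]:]"
    using det by (simp add: is_unit_const_poly_iff dvd_field_iff)
  ultimately have "[:L:] dvd q"
    by (simp add: dvd_mult_unit_iff' del: mult_pCons_left)
  then obtain q' where "q = [:L:] * q'" ..
  then have "[:L:] * H' = [:L:] * (F_poly a b c d * q')"
    using q by (simp add: ac_simps del: mult_pCons_left mult_pCons_right)
  moreover have "[:L:] \<noteq> 0"
    using det by (auto simp: L_def)
  ultimately have "H' = F_poly a b c d * q'"
    using mult_left_cancel by blast
  then show ?case
    using Suc.IH by (simp add: H'_def L_def)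
qed simp

text \<open>Pseudo-division by \<open>F\<close>, which is linear in \<open>s\<close>, leaves a remainder in \<open>t\<close> alone. The remainder vanishes
  at infinitely many \<open>t\<close>, hence \<open>F\<close> divides \<open>H\<close> times a power of the leading coefficient \<open>c t + d\<close>.\<close>

lemma F_poly_dvdI:
  assumes det: "a * d - b * c \<noteq> 0"
    and inf: "infinite {t. c * t + d \<noteq> 0 \<and> poly (poly H [:moebius a b c d t:]) t = 0}"
  shows "F_poly a b c d dvd H"
proof -
  define F where "F = F_poly a b c d"
  have L: "[:d, c:] \<noteq> 0" using det by auto
  then have F: "degree F = 1" "coeff F 1 = [:d, c:]" "F \<noteq> 0"
    by (auto simp: F_def F_poly_eq)
  obtain q r where qr: "pseudo_divmod H F = (q, r)" by fastforce
  have eq: "smult ([:d, c:] ^ (Suc (degree H) - 1)) H = F * q + r"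
    and deg: "r = 0 \<or> degree r < degree F"
    using pseudo_divmod[OF F(3) qr] F by auto
  then obtain r0 where r0: "r = [:r0:]"
    using F(1) by (metis degree_eq_zeroE degree_0 less_one)
  have "poly r0 t = 0"
    if "c * t + d \<noteq> 0 \<and> poly (poly H [:moebius a b c d t:]) t = 0" for t
  proof -
    have "poly (poly (smult ([:d, c:] ^ (Suc (degree H) - 1)) H) [:moebius a b c d t:]) t = 0"
      using that by simp
    then show ?thesis
      unfolding eq using that by (simp add: F_def F_poly_root r0)
  qed
  then have "infinite {t. poly r0 t = 0}"
    using inf by (auto elim!: infinite_super[rotated])
  then have "r = 0"
    using poly_roots_finite r0 by auto
  then show ?thesis
    using eq F_poly_dvd_cancel[OF det] by (metis F_def add_0_right dvd_triv_left)
qed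

text \<open>The form \<open>\<Sum> r\<^sub>i u\<^sup>i v\<^sup>m\<^sup>-\<^sup>i\<close> of degree \<open>m\<close> that belongs to \<open>R\<close>, evaluated at \<open>u = P\<close> and \<open>v = Q\<close>. It clears
  denominators in \<open>R (P / Q)\<close>. Modulo \<open>Q\<close> only its last term survives, modulo \<open>P\<close> only its
  first.\<close>

definition homogenize :: "nat \<Rightarrow> real poly \<Rightarrow> real poly \<Rightarrow> real poly \<Rightarrow> real poly" where
  "homogenize m R P Q = (\<Sum>i\<le>m. smult (coeff R i) (P ^ i * Q ^ (m - i)))"

lemma poly_homogenize:
  assumes "degree R \<le> m" "poly Q t \<noteq> 0"
  shows "poly (homogenize m R P Q) t = poly Q t ^ m * poly R (poly P t / poly Q t)"
proof -
  have "poly R u = (\<Sum>i\<le>m. coeff R i * u ^ i)" for u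
    unfolding poly_altdef using assms(1)
    by (intro sum.mono_neutral_left) (auto simp: coeff_eq_0)
  then show ?thesis
    using assms(2)
    by (auto simp: homogenize_def poly_sum sum_distrib_left power_diff power_divide intro!: sum.cong)
qed

lemma homogenize_cong_last: "Q dvd homogenize m R P Q - smult (coeff R m) (P ^ m)"
proof -
  have "homogenize m R P Q - smult (coeff R m) (P ^ m)
      = (\<Sum>i<m. smult (coeff R i) (P ^ i * Q ^ (m - i)))"
    by (simp add: homogenize_def flip: lessThan_Suc_atMost)
  also have "Q dvd \<dots>"
    by (intro dvd_sum dvd_smult dvd_mult dvd_power) auto
  finally show ?thesis .
qed

lemma homogenize_cong_first: "P dvd homogenize m R P Q - smult (coeff R 0) (Q ^ m)"
proof -
  have "homogenize m R P Q - smult (coeff R 0) (Q ^ m)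
      = (\<Sum>i<m. smult (coeff R (Suc i)) (P ^ Suc i * Q ^ (m - Suc i)))"
    unfolding homogenize_def lessThan_Suc_atMost[symmetric]
    by (subst sum.lessThan_Suc_shift) simp
  also have "P dvd \<dots>"
    by (intro dvd_sum dvd_smult dvd_mult2) auto
  finally show ?thesis .
qed

text \<open>Clearing denominators in \<open>(R / W) (P / Q) = t\<close> gives an identity \<open>R\<^sup>h(P, Q) = t W\<^sup>h(P, Q)\<close> of
  polynomials in \<open>t\<close>. Reducing it modulo \<open>Q\<close> shows that \<open>Q\<close> divides \<open>(r\<^sub>m - t w\<^sub>m) P\<^sup>m\<close>, so by coprimality it
  divides the linear polynomial \<open>r\<^sub>m - t w\<^sub>m\<close>. Modulo \<open>P\<close> the same argument shows that \<open>P\<close> divides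
  \<open>r\<^sub>0 - t w\<^sub>0\<close>. Both are nonzero: \<open>m\<close> is the larger degree, and \<open>0\<close> is not a common root of \<open>R\<close>
  and \<open>W\<close>.\<close>

lemma left_invertible_rational_degree:
  fixes P Q R W :: "real poly"
  assumes PQ: "coprime P Q" and RW: "coprime R W"
    and U: "infinite U"
    and inv: "\<And>t. t \<in> U \<Longrightarrow> poly Q t \<noteq> 0 \<and> poly W (poly P t / poly Q t) \<noteq> 0
               \<and> poly R (poly P t / poly Q t) / poly W (poly P t / poly Q t) = t"
  shows "degree P \<le> 1" "degree Q \<le> 1"
proof -
  define m where "m = max (degree R) (degree W)"
  let ?R = "homogenize m R P Q" and ?W = "homogenize m W P Q"
  have "poly (?R - [:0, 1:] * ?W) t = 0" if "t \<in> U" for t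
  proof -
    have "poly ?R t = t * poly ?W t"
      using inv[OF that] by (subst (1 2) poly_homogenize) (auto simp: m_def field_simps)
    then show ?thesis by simp
  qed
  then have "infinite {t. poly (?R - [:0, 1:] * ?W) t = 0}"
    using U by (auto elim!: infinite_super[rotated])
  then have RW': "?R = [:0, 1:] * ?W"
    using poly_roots_finite[of "?R - [:0, 1:] * ?W"] by auto
  have degree_le: "degree S \<le> 1"
    if "coprime S V" and nz: "r \<noteq> 0 \<or> w \<noteq> 0"
      and "S dvd ?R - smult r (V ^ m)" "S dvd ?W - smult w (V ^ m)" for S V r w
  proof -
    have "S dvd [:0, 1:] * (?W - smult w (V ^ m)) - (?R - smult r (V ^ m))"
      by (intro dvd_diff dvd_mult that)
    also have "\<dots> = V ^ m * [:r, - w:]"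
      unfolding RW' by (simp add: algebra_simps)
    finally have "S dvd [:r, - w:]"
      using \<open>coprime S V\<close> by (metis coprime_dvd_mult_right_iff coprime_power_right_iff)
    then have "degree S \<le> degree [:r, - w:]"
      using nz by (intro dvd_imp_degree_le) auto
    also have "\<dots> \<le> 1" by simp
    finally show ?thesis .
  qed
  have "R \<noteq> 0 \<or> W \<noteq> 0"
    using RW by auto
  moreover have "coeff R m \<noteq> 0" if "degree W \<le> degree R" "R \<noteq> 0"
    using that by (simp add: m_def)
  moreover have "coeff W m \<noteq> 0" if "degree R \<le> degree W" "W \<noteq> 0"
    using that by (simp add: m_def)
  ultimately have "coeff R m \<noteq> 0 \<or> coeff W m \<noteq> 0"
    by (cases "R = 0"; cases "W = 0"; cases "degree R \<le> degree W") auto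
  then show "degree Q \<le> 1"
    using PQ homogenize_cong_last by (intro degree_le[of Q P]) (auto simp: coprime_commute)
  have "coeff R 0 \<noteq> 0 \<or> coeff W 0 \<noteq> 0"
  proof (rule ccontr)
    assume "\<not> ?thesis"
    then have "[:0, 1:] dvd R" "[:0, 1:] dvd W"
      by (simp_all add: poly_eq_0_iff_dvd[of _ 0, simplified] flip: poly_0_coeff_0)
    then have "is_unit [:0, 1 :: real:]"
      using RW by (rule coprime_common_divisor[rotated])
    then show False by (simp add: is_unit_poly_iff)
  qed
  then show "degree P \<le> 1"
    using PQ homogenize_cong_first by (intro degree_le[of P Q])
qed

section \<open>Zariski closures of rational curves\<close>

lemma zariski_closure_superset: "q \<in> S \<Longrightarrow> q \<in> zariski_closure S"
  by (simp add: zariski_closure_def)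

lemma zariski_closureD:
  "p \<in> zariski_closure S \<Longrightarrow> real_polynomial_function g \<Longrightarrow> (\<And>q. q \<in> S \<Longrightarrow> g q = 0) \<Longrightarrow> g p = 0"
  unfolding zariski_closure_def by blast

lemma real_polynomial_function_affine:
  assumes "real_polynomial_function g"
  shows "real_polynomial_function (\<lambda>p. g (Q *v p + b :: real ^ 'n))"
proof -
  have "polynomial_function (\<lambda>p. Q *v p + b)"
    by (intro polynomial_function_add polynomial_function_const
        polynomial_function_bounded_linear matrix_vector_mul_bounded_linear)
  then show ?thesis
    using real_polynomial_function_compose[OF _ assms] by (simp add: o_def)
qed

lemma real_polynomial_function_component: "real_polynomial_function (\<lambda>p :: real ^ 'n. p $ i)"
  by (simp add: real_polynomial_function.intros(1) bounded_linear_vec_nth)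

lemma
  fixes x :: "(rat poly fract) ^ 3"
  shows finite_poles: "finite (- rf_dom x)"
    and open_rf_dom: "open (rf_dom x)"
    and rational_curve_rf_map: "rational_curve (rf_dom x) (rf_map x)"
proof -
  have "rf_den r \<noteq> 0" for r
    by (simp add: rf_den_def map_poly_eq_0_iff)
  then have "finite (\<Union>i. {t. poly (rf_den (x $ i)) t = 0})"
    by (auto intro: poly_roots_finite)
  moreover have "- rf_dom x = (\<Union>i. {t. poly (rf_den (x $ i)) t = 0})"
    by (auto simp: rf_dom_def)
  ultimately show fin: "finite (- rf_dom x)" by simp
  then have "closed (- rf_dom x)"
    by (rule finite_imp_closed)
  then show "open (rf_dom x)"
    by (simp add: closed_def)
  show "rational_curve (rf_dom x) (rf_map x)"
    unfolding rational_curve_def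
  proof (intro allI)
    fix i
    show "rational_on (rf_dom x) (\<lambda>t. rf_map x t $ i)"
      by (rule rational_onI[of _ "rf_den (x $ i)" _ "rf_num (x $ i)"])
         (simp add: rf_dom_def rf_map_def)
  qed
qed

lemma rf_map_in_curve: "t \<in> rf_dom x \<Longrightarrow> rf_map x t \<in> curve x"
  by (simp add: curve_def zariski_closure_superset)

text \<open>Irreducibility of the curve, read off from its parametrization: by the identity principle the
  polynomial vanishes on the whole image, hence on its closure.\<close>

lemma curve_vanishing:
  assumes "real_polynomial_function g" "infinite {t \<in> rf_dom x. g (rf_map x t) = 0}" "p \<in> curve x"
  shows "g p = 0"
proof -
  have "rational_on (rf_dom x) (\<lambda>t. g (rf_map x t))"
    using assms(1) rational_curve_rf_map by (rule rational_on_real_polynomial_function)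
  then have "g (rf_map x t) = 0" if "t \<in> rf_dom x" for t
    using rational_on_eqI[OF _ rational_on_const[of _ 0]] assms(2) that by blast
  then show ?thesis
    using zariski_closureD[OF assms(3)[unfolded curve_def] assms(1)] by blast
qed

text \<open>The composition of an equation of the curve with the affine map vanishes at infinitely many
  parameters, hence on the whole curve. So exceptional parameters do no harm.\<close>

lemma affine_map_preserves_curve:
  assumes inf: "infinite {t \<in> rf_dom x. Q *v rf_map x t + b \<in> curve x}" and p: "p \<in> curve x"
  shows "Q *v p + b \<in> curve x"
  unfolding curve_def zariski_closure_def
proof safe
  fix g :: "real ^ 3 \<Rightarrow> real"
  assume g: "real_polynomial_function g" "\<forall>q \<in> rf_map x ` rf_dom x. g q = 0"
  have "g q = 0" if "q \<in> curve x" for q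
    using zariski_closureD[OF that[unfolded curve_def] g(1)] g(2) by blast
  then have "infinite {t \<in> rf_dom x. g (Q *v rf_map x t + b) = 0}"
    using inf by (auto elim!: infinite_super[rotated])
  then show "g (Q *v p + b) = 0"
    using curve_vanishing[OF real_polynomial_function_affine[OF g(1)] _ p] by blast
qed

lemma affine_map_fixes_curve:
  assumes inf: "infinite {t \<in> rf_dom x. Q *v rf_map x t + b = rf_map x t}" and p: "p \<in> curve x"
  shows "Q *v p + b = p"
proof (rule vec_eq_iff[THEN iffD2], rule allI)
  fix i
  have "real_polynomial_function (\<lambda>p. (Q *v p + b) $ i - p $ i)"
    by (intro real_polynomial_function_diff real_polynomial_function_component
        real_polynomial_function_affine[of "\<lambda>p. p $ i"])
  moreover have "infinite {t \<in> rf_dom x. (Q *v rf_map x t + b) $ i - rf_map x t $ i = 0}"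
    by (rule infinite_super[OF _ inf]) (auto simp flip: vector_add_component)
  ultimately show "(Q *v p + b) $ i = p $ i"
    using curve_vanishing[OF _ _ p] by fastforce
qed

text \<open>The set \<open>D\<close> collects the parameters that the inverse \<open>g / h\<close> recovers.\<close>

lemma proper_parametrizationE:
  assumes "proper_parametrization x"
  obtains g h D where "real_polynomial_function g" "real_polynomial_function h"
    "D \<subseteq> rf_dom x" "finite (- D)"
    "\<forall>t\<in>D. h (rf_map x t) \<noteq> 0 \<and> g (rf_map x t) / h (rf_map x t) = t"
    "inj_on (rf_map x) D"
    "finite {p \<in> curve x. \<not> (h p \<noteq> 0 \<and> g p / h p \<in> rf_dom x \<and> rf_map x (g p / h p) = p)}"
proof -
  obtain g h where gh: "real_polynomial_function g" "real_polynomial_function h"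
    and fin: "finite {t \<in> rf_dom x. \<not> (h (rf_map x t) \<noteq> 0 \<and> g (rf_map x t) / h (rf_map x t) = t)}"
    and fin': "finite {p \<in> curve x.
          \<not> (h p \<noteq> 0 \<and> g p / h p \<in> rf_dom x \<and> rf_map x (g p / h p) = p)}"
    using assms unfolding proper_parametrization_def by blast
  define D where "D = {t \<in> rf_dom x. h (rf_map x t) \<noteq> 0 \<and> g (rf_map x t) / h (rf_map x t) = t}"
  have "finite (- D)"
    by (rule finite_subset[OF _ finite_UnI[OF finite_poles[of x] fin]]) (auto simp: D_def)
  moreover have "inj_on (rf_map x) D"
    by (rule inj_onI) (metis (mono_tags, lifting) D_def mem_Collect_eq)
  ultimately show ?thesis
    using gh fin' by (intro that[of g h D]) (auto simp: D_def)
qed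

lemma infinite_cofinite_real: "finite (- D) \<Longrightarrow> infinite (D :: real set)"
  using infinite_UNIV_char_0 by (metis Compl_partition finite_UnI sup_commute)

lemma infinite_open_real: "open S \<Longrightarrow> S \<noteq> {} \<Longrightarrow> infinite (S :: real set)"
  using finite_imp_not_open by blast

lemma proper_parametrization_not_constant:
  assumes "proper_parametrization x"
  shows "finite {t \<in> rf_dom x. rf_map x t = p}"
proof (rule ccontr)
  assume "\<not> ?thesis"
  then have const: "rf_map x t = p" if "t \<in> rf_dom x" for t
    using rational_curve_eqI[OF rational_curve_rf_map rational_curve_const _ that] by blast
  obtain D where D: "D \<subseteq> rf_dom x" "finite (- D)" "inj_on (rf_map x) D"
    using assms by (rule proper_parametrizationE)
  have "finite (rf_map x ` D)"
    by (rule finite_subset[of _ "{p}"]) (use D(1) const in auto)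
  then have "finite D"
    using D(3) by (rule finite_imageD)
  then show False
    using D(2) infinite_cofinite_real by blast
qed

text \<open>Where the \<open>i\<close>-th component \<open>u\<close> of the velocity does not vanish, \<open>X' \<times> X'' = 0\<close> says that the derivative of
  \<open>X' / u\<close> is zero. So the velocity has a constant direction \<open>w\<close> near \<open>t0\<close>, normalized to \<open>w $ i = 1\<close>, and
  \<open>X - X\<^sub>i w\<close> is constant there. The identity principle extends this to all parameters.\<close>

lemma rational_curve_in_line:
  assumes X: "rational_curve U X" and U: "open U" and t0: "t0 \<in> U" "vderiv X t0 \<noteq> 0"
    and flat: "\<And>t. t \<in> U \<Longrightarrow> vderiv X t \<times> vderiv (vderiv X) t = 0"
  shows "\<exists>i p w. w $ i = 1 \<and> (\<forall>t\<in>U. X t = p + (X t $ i) *\<^sub>R w)"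
proof -
  note X1 = rational_curve_vderiv(2)[OF X U]
  obtain i where i: "vderiv X t0 $ i \<noteq> 0"
    using t0 by (auto simp: vec_eq_iff)
  define u where "u t = vderiv X t $ i" for t
  have rat_u: "rational_on U u" and rat_Xi: "rational_on U (\<lambda>t. X t $ i)"
    using X X1 by (auto simp: u_def[abs_def] rational_curve_def)
  have "continuous_on U u"
    by (intro continuous_at_imp_continuous_on ballI
        DERIV_isCont[OF rational_on_deriv(1)[OF rat_u U]])
  then have "open {t \<in> U. u t \<noteq> 0}"
    using continuous_open_preimage[OF _ U, of u "- {0}"]
    by (simp add: vimage_def Int_def open_Compl)
  then obtain e where e: "e > 0" "ball t0 e \<subseteq> {t \<in> U. u t \<noteq> 0}"
    using t0(1) i by (auto simp: open_contains_ball u_def)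
  have comp: "((\<lambda>t. y t $ i) has_field_derivative y' $ i) (at t)"
    if "(y has_vector_derivative y') (at t)" for y :: "real \<Rightarrow> real ^ 3" and y' t
    using bounded_linear.has_vector_derivative[OF bounded_linear_vec_nth that]
    by (simp add: has_real_derivative_iff_has_vector_derivative)
  have "((\<lambda>t. inverse (u t) *\<^sub>R vderiv X t) has_vector_derivative 0) (at t)"
    if "t \<in> ball t0 e" for t
  proof -
    have t: "t \<in> U" "u t \<noteq> 0" using that e(2) by auto
    let ?v = "vderiv (vderiv X) t"
    note v = rational_curve_vderiv(1)[OF X1 U t(1)]
    have "axis i 1 \<times> (vderiv X t \<times> ?v) = ?v $ i *\<^sub>R vderiv X t - u t *\<^sub>R ?v"
      by (simp add: Lagrange inner_axis' u_def)
    then have par: "?v $ i *\<^sub>R vderiv X t = u t *\<^sub>R ?v"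
      using flat[OF t(1)] by simp
    have "((\<lambda>t. inverse (u t) *\<^sub>R vderiv X t) has_vector_derivative
        inverse (u t) *\<^sub>R ?v + (- (inverse (u t) * ?v $ i * inverse (u t))) *\<^sub>R vderiv X t) (at t)"
      using t comp[OF v] by (intro has_vector_derivative_scaleR DERIV_inverse' v) (auto simp: u_def)
    moreover have "(inverse (u t) * ?v $ i * inverse (u t)) *\<^sub>R vderiv X t
        = inverse (u t) *\<^sub>R inverse (u t) *\<^sub>R (?v $ i *\<^sub>R vderiv X t)"
      by (simp add: mult.commute)
    moreover have "\<dots> = inverse (u t) *\<^sub>R ?v"
      unfolding par using t(2) by simp
    ultimately show ?thesis by simp
  qed
  then obtain w where w: "\<And>t. t \<in> ball t0 e \<Longrightarrow> inverse (u t) *\<^sub>R vderiv X t = w"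
    using constant_of_zero_derivative[OF convex_ball, of t0 e "\<lambda>t. inverse (u t) *\<^sub>R vderiv X t"]
    by blast
  have X': "vderiv X t = u t *\<^sub>R w" if "t \<in> ball t0 e" for t
  proof -
    have "u t \<noteq> 0" using that e(2) by auto
    then show ?thesis by (simp flip: w[OF that])
  qed
  have "((\<lambda>t. X t - (X t $ i) *\<^sub>R w) has_vector_derivative 0) (at t)" if "t \<in> ball t0 e" for t
  proof -
    have D: "(X has_vector_derivative vderiv X t) (at t)"
      using that e(2) by (intro rational_curve_vderiv(1)[OF X U]) auto
    show ?thesis
      using has_vector_derivative_diff[OF D
          has_vector_derivative_scaleR[OF comp[OF D] has_vector_derivative_const[of w]]]
        X'[OF that, unfolded u_def, symmetric]
      by simp
  qed
  then obtain p where p: "\<And>t. t \<in> ball t0 e \<Longrightarrow> X t - (X t $ i) *\<^sub>R w = p"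
    using constant_of_zero_derivative[OF convex_ball, of t0 e "\<lambda>t. X t - (X t $ i) *\<^sub>R w"]
    by blast
  show ?thesis
  proof (intro exI conjI ballI)
    show "w $ i = 1"
      using w[of t0] e(1) i by (auto simp: u_def)
    fix t assume t: "t \<in> U"
    have "rational_curve U (\<lambda>t. p + (X t $ i) *\<^sub>R w)"
      by (intro rational_curve_add rational_curve_scaleR rational_curve_const rat_Xi)
    moreover have "infinite {t \<in> U. X t = p + (X t $ i) *\<^sub>R w}"
    proof (rule infinite_super)
      show "infinite (ball t0 e)"
        using e(1) by (intro infinite_open_real) auto
      show "ball t0 e \<subseteq> {t \<in> U. X t = p + (X t $ i) *\<^sub>R w}"
      proof
        fix t assume t: "t \<in> ball t0 e"
        have "X t = p + (X t $ i) *\<^sub>R w"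
          using p[OF t] by (metis add.commute diff_add_cancel)
        then show "t \<in> {t \<in> U. X t = p + (X t $ i) *\<^sub>R w}"
          using e(2) t by blast
      qed
    qed
    ultimately show "X t = p + (X t $ i) *\<^sub>R w"
      using rational_curve_eqI[OF X _ _ t] by blast
  qed
qed

text \<open>The image lies in a line by \<open>rational_curve_in_line\<close>. The closure is the whole line, because a
  polynomial that vanishes at infinitely many points of a line vanishes on it.\<close>

lemma is_line_curve:
  assumes proper: "proper_parametrization x"
    and flat: "\<And>t. t \<in> rf_dom x \<Longrightarrow> vderiv (rf_map x) t \<times> vderiv (vderiv (rf_map x)) t = 0"
  shows "is_line (curve x)"
proof -
  note X = rational_curve_rf_map[of x] and dom = open_rf_dom[of x]
  have dom_ne: "rf_dom x \<noteq> {}"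
    using infinite_cofinite_real[OF finite_poles[of x]] by auto
  have "\<exists>t\<in>rf_dom x. vderiv (rf_map x) t \<noteq> 0"
  proof (rule ccontr)
    assume zero: "\<not> ?thesis"
    obtain t0 e where e: "e > 0" "ball t0 e \<subseteq> rf_dom x"
      using dom dom_ne by (meson ex_in_conv open_contains_ball)
    have "(rf_map x has_vector_derivative 0) (at t)" if "t \<in> ball t0 e" for t
      using rational_curve_vderiv(1)[OF X dom, of t] zero e(2) that by auto
    then obtain p where "\<And>t. t \<in> ball t0 e \<Longrightarrow> rf_map x t = p"
      using constant_of_zero_derivative[OF convex_ball, of t0 e "rf_map x"] by blast
    then have "ball t0 e \<subseteq> {t \<in> rf_dom x. rf_map x t = p}"
      using e(2) by auto
    then show False
      using proper_parametrization_not_constant[OF proper] infinite_open_real[of "ball t0 e"] e(1)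
      by (meson finite_subset open_ball ball_eq_empty not_le)
  qed
  then obtain t0 where t0: "t0 \<in> rf_dom x" "vderiv (rf_map x) t0 \<noteq> 0" by blast
  obtain i p w where w: "w $ i = 1"
    and line: "\<And>t. t \<in> rf_dom x \<Longrightarrow> rf_map x t = p + (rf_map x t $ i) *\<^sub>R w"
    using rational_curve_in_line[OF X dom t0 flat] by blast
  have "curve x = range (\<lambda>u. p + u *\<^sub>R w)"
  proof (intro equalityI subsetI)
    fix q assume q: "q \<in> curve x"
    have "q $ j - (p $ j + q $ i * w $ j) = 0" for j
    proof (rule curve_vanishing[OF _ _ q])
      show "real_polynomial_function (\<lambda>q. q $ j - (p $ j + q $ i * w $ j))"
        by (intro real_polynomial_function_diff real_polynomial_function.intros(3)
            real_polynomial_function.intros(4) real_polynomial_function.intros(2)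
            real_polynomial_function_component)
      have "rf_map x t $ j = p $ j + rf_map x t $ i * w $ j" if "t \<in> rf_dom x" for t
        using arg_cong[OF line[OF that], of "\<lambda>q. q $ j"] by simp
      then have "{t \<in> rf_dom x. rf_map x t $ j - (p $ j + rf_map x t $ i * w $ j) = 0} = rf_dom x"
        by auto
      then show "infinite {t \<in> rf_dom x. rf_map x t $ j - (p $ j + rf_map x t $ i * w $ j) = 0}"
        using infinite_cofinite_real[OF finite_poles[of x]] by simp
    qed
    then have "(p + (q $ i) *\<^sub>R w) $ j = q $ j" for j
      unfolding vector_add_component vector_scaleR_component real_scaleR_def
      by (metis eq_iff_diff_eq_0)
    then have "p + (q $ i) *\<^sub>R w = q"
      unfolding vec_eq_iff by blast
    then show "q \<in> range (\<lambda>u. p + u *\<^sub>R w)"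
      by (metis rangeI)
  next
    fix q assume "q \<in> range (\<lambda>u. p + u *\<^sub>R w)"
    then obtain u where u: "q = p + u *\<^sub>R w" by blast
    show "q \<in> curve x"
      unfolding curve_def zariski_closure_def
    proof safe
      fix g :: "real ^ 3 \<Rightarrow> real"
      assume g: "real_polynomial_function g" "\<forall>q \<in> rf_map x ` rf_dom x. g q = 0"
      have rat: "rational_on UNIV (\<lambda>u. g (p + u *\<^sub>R w))"
        by (intro rational_on_real_polynomial_function[OF g(1)] rational_curve_add
            rational_curve_scaleR rational_curve_const rational_on_ident)
      define V where "V = (\<lambda>t. rf_map x t $ i) ` rf_dom x"
      have "infinite V"
      proof
        assume "finite V"
        then have "finite (\<Union>v\<in>V. {t \<in> rf_dom x. rf_map x t = p + v *\<^sub>R w})"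
          using proper_parametrization_not_constant[OF proper] by blast
        moreover have "rf_dom x \<subseteq> (\<Union>v\<in>V. {t \<in> rf_dom x. rf_map x t = p + v *\<^sub>R w})"
        proof
          fix t assume t: "t \<in> rf_dom x"
          then have "t \<in> {s \<in> rf_dom x. rf_map x s = p + (rf_map x t $ i) *\<^sub>R w}"
            using line by blast
          moreover have "rf_map x t $ i \<in> V"
            using t by (simp add: V_def)
          ultimately show "t \<in> (\<Union>v\<in>V. {t \<in> rf_dom x. rf_map x t = p + v *\<^sub>R w})"
            by blast
        qed
        ultimately have "finite (rf_dom x)"
          by (rule finite_subset[rotated])
        then show False
          using infinite_cofinite_real[OF finite_poles[of x]] by blast
      qed
      moreover have "g (p + v *\<^sub>R w) = 0" if v: "v \<in> V" for v
      proof -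
        obtain t where t: "t \<in> rf_dom x" "v = rf_map x t $ i"
          using v by (auto simp: V_def)
        then have "rf_map x t = p + v *\<^sub>R w"
          using line by blast
        then show ?thesis
          using g(2) t(1) by (metis imageI)
      qed
      ultimately have "infinite {u \<in> UNIV. g (p + u *\<^sub>R w) = 0}"
        by (auto elim!: infinite_super[rotated])
      then show "g q = 0"
        using rational_on_eqI[OF rat rational_on_const[of _ 0], of u] u by simp
    qed
  qed
  moreover have "w \<noteq> 0" using w by auto
  ultimately show ?thesis
    unfolding is_line_def by blast
qed

section \<open>Regular parameters and Moebius changes of parameter\<close>

text \<open>Where the velocity vanishes, the quotient that defines the curvature is \<open>0 / 0 = 0\<close>, so regularity
  can be expressed by the curvature and is transferred along with it.\<close>

lemma curvature_eq_0_iff: "curvature y t = 0 \<longleftrightarrow> vderiv y t \<times> vderiv (vderiv y) t = 0"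
  by (auto simp: curvature_def)

lemma curvature_nonneg: "curvature y t \<ge> 0"
  by (simp add: curvature_def)

lemma torsion_dom_eq: "torsion_dom x = {t \<in> rf_dom x. curvature (rf_map x) t \<noteq> 0}"
  by (simp add: torsion_dom_def curvature_eq_0_iff)

lemma torsion_dom_subset_curvature_dom: "torsion_dom x \<subseteq> curvature_dom x"
  by (auto simp: torsion_dom_def curvature_dom_def)

lemma open_torsion_dom: "open (torsion_dom x)"
proof -
  note X = rational_curve_rf_map[of x] and dom = open_rf_dom[of x]
  note X1 = rational_curve_vderiv(2)[OF X dom]
  note X2 = rational_curve_vderiv(2)[OF X1 dom]
  have "continuous_on (rf_dom x) (\<lambda>t. vderiv (rf_map x) t \<times> vderiv (vderiv (rf_map x)) t)"
    by (intro continuous_on_cross rational_curve_continuous[OF X1 dom]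
        rational_curve_continuous[OF X2 dom])
  from continuous_open_preimage[OF this dom, of "- {0}"] show ?thesis
    by (simp add: torsion_dom_def vimage_def Int_def open_Compl)
qed

lemma invariants_cong:
  assumes S: "open S" "\<And>t. t \<in> S \<Longrightarrow> y t = z t" and t: "t \<in> S"
  shows "speed y t = speed z t" "curvature y t = curvature z t" "torsion y t = torsion z t"
proof -
  have 1: "vderiv y t = vderiv z t" if "t \<in> S" for t
    using vderiv_cong[OF S that] .
  have 2: "vderiv (vderiv y) t = vderiv (vderiv z) t" if "t \<in> S" for t
    using vderiv_cong[OF S(1) 1 that] .
  have 3: "vderiv (vderiv (vderiv y)) t = vderiv (vderiv (vderiv z)) t"
    using vderiv_cong[OF S(1) 2 t] .
  show "speed y t = speed z t" "curvature y t = curvature z t" "torsion y t = torsion z t"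
    by (simp_all add: speed_def curvature_def torsion_def 1 2 3 t)
qed

lemma inj_on_moebius:
  assumes "a * d - b * c \<noteq> 0"
  shows "inj_on (moebius a b c d) {t. c * t + d \<noteq> 0}"
proof (rule inj_onI)
  fix s t assume *: "s \<in> {t. c * t + d \<noteq> 0}" "t \<in> {t. c * t + d \<noteq> 0}"
    "moebius a b c d s = moebius a b c d t"
  then have "(a * s + b) * (c * t + d) = (a * t + b) * (c * s + d)"
    by (simp add: moebius_def frac_eq_eq)
  then have "(a * d - b * c) * (s - t) = 0"
    by (simp add: algebra_simps)
  then show "s = t"
    using assms by simp
qed

lemma finite_moebius_preimage:
  assumes det: "a * d - b * c \<noteq> 0" and E: "finite (- E)"
  shows "finite (- {t. c * t + d \<noteq> 0 \<and> moebius a b c d t \<in> E})"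
proof -
  have "[:d, c:] \<noteq> 0" using det by auto
  then have "finite {t. poly [:d, c:] t = 0}"
    by (rule poly_roots_finite)
  moreover have "finite (moebius a b c d -` (- E) \<inter> {t. c * t + d \<noteq> 0})"
    using E inj_on_moebius[OF det] by (rule finite_vimage_IntI)
  ultimately show ?thesis
    by (rule finite_subset[rotated, OF finite_UnI]) (auto simp: algebra_simps)
qed

lemma deriv_moebius:
  assumes "c * t + d \<noteq> 0"
  shows "deriv (moebius a b c d) t = (a * d - b * c) / (c * t + d)\<^sup>2"
proof -
  have "((\<lambda>t. (a * t + b) / (c * t + d)) has_field_derivative
      (a * d - b * c) / (c * t + d)\<^sup>2) (at t)"
    using assms by (auto intro!: derivative_eq_intros simp: power2_eq_square algebra_simps)
  then show ?thesis
    unfolding moebius_def[abs_def] by (rule DERIV_imp_deriv)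
qed

definition moebius_dom :: "(rat poly fract) ^ 3 \<Rightarrow> real \<Rightarrow> real \<Rightarrow> real \<Rightarrow> real \<Rightarrow> real set" where
  "moebius_dom x a b c d =
     {t. t \<in> rf_dom x \<and> c * t + d \<noteq> 0 \<and> moebius a b c d t \<in> rf_dom x}"

lemma
  assumes det: "a * d - b * c \<noteq> 0"
  shows finite_moebius_dom: "finite (- moebius_dom x a b c d)"
    and open_moebius_dom: "open (moebius_dom x a b c d)"
    and rational_on_moebius_dom: "rational_on (moebius_dom x a b c d) (moebius a b c d)"
    and rational_curve_moebius:
      "rational_curve (moebius_dom x a b c d) (\<lambda>t. rf_map x (moebius a b c d t))"
proof -
  have "- moebius_dom x a b c d =
      - rf_dom x \<union> - {t. c * t + d \<noteq> 0 \<and> moebius a b c d t \<in> rf_dom x}"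
    by (auto simp: moebius_dom_def)
  then show fin: "finite (- moebius_dom x a b c d)"
    using finite_poles finite_moebius_preimage[OF det] by (metis finite_UnI)
  then have "closed (- moebius_dom x a b c d)"
    by (rule finite_imp_closed)
  then show "open (moebius_dom x a b c d)"
    by (simp add: closed_def)
  show rat: "rational_on (moebius_dom x a b c d) (moebius a b c d)"
    by (rule rational_on_moebius) (simp add: moebius_dom_def)
  show "rational_curve (moebius_dom x a b c d) (\<lambda>t. rf_map x (moebius a b c d t))"
    by (rule rational_curve_compose[OF rational_curve_rf_map rat]) (simp add: moebius_dom_def)
qed

lemma
  assumes det: "a * d - b * c \<noteq> 0" and t: "t \<in> moebius_dom x a b c d"
  defines "y \<equiv> \<lambda>t. rf_map x (moebius a b c d t)"
  shows speed_moebius: "speed y t =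
      \<bar>deriv (moebius a b c d) t\<bar> * speed (rf_map x) (moebius a b c d t)"
    and curvature_moebius: "curvature y t = curvature (rf_map x) (moebius a b c d t)"
    and torsion_moebius: "torsion y t = torsion (rf_map x) (moebius a b c d t)"
proof -
  note X = rational_curve_rf_map[of x] and dom = open_rf_dom[of x]
  note mu = rational_on_moebius_dom[OF det, of x] and S = open_moebius_dom[OF det, of x]
  have maps: "moebius a b c d ` moebius_dom x a b c d \<subseteq> rf_dom x"
    by (auto simp: moebius_dom_def)
  have "c * t + d \<noteq> 0"
    using t by (simp add: moebius_dom_def)
  then have nz: "deriv (moebius a b c d) t \<noteq> 0"
    using det by (simp add: deriv_moebius)
  show "speed y t = \<bar>deriv (moebius a b c d) t\<bar> * speed (rf_map x) (moebius a b c d t)"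
    unfolding y_def speed_def reparametrized_derivatives(1)[OF X dom mu S maps t] by simp
  show "curvature y t = curvature (rf_map x) (moebius a b c d t)"
    unfolding y_def by (rule curvature_reparametrized[OF X dom mu S maps t nz])
  show "torsion y t = torsion (rf_map x) (moebius a b c d t)"
    unfolding y_def by (rule torsion_reparametrized[OF X dom mu S maps t nz])
qed

lemma is_reduced_fractionD:
  "is_reduced_fraction P Q g S \<Longrightarrow> t \<in> S \<Longrightarrow> poly Q t \<noteq> 0 \<Longrightarrow> g t = poly P t / poly Q t"
  unfolding is_reduced_fraction_def by blast

text \<open>The parameters at which the invariants at \<open>t\<close> and at its image can be compared through the
  reduced fractions with denominators \<open>B\<close> and \<open>D\<close>. Nonzero curvature is demanded at \<open>t\<close> only; at the image
  it will follow from equality of the invariants.\<close>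

definition comparison_dom :: "(rat poly fract) ^ 3 \<Rightarrow> real poly \<Rightarrow> real poly \<Rightarrow>
    real \<Rightarrow> real \<Rightarrow> real \<Rightarrow> real \<Rightarrow> real set" where
  "comparison_dom x B D a b c d = {t \<in> torsion_dom x \<inter> moebius_dom x a b c d.
     poly (B * D) t \<noteq> 0 \<and> poly (B * D) (moebius a b c d t) \<noteq> 0}"

lemma
  assumes proper: "proper_parametrization x" and line: "\<not> is_line (curve x)"
    and det: "a * d - b * c \<noteq> 0" and BD: "B * D \<noteq> 0"
  shows open_comparison_dom: "open (comparison_dom x B D a b c d)"
    and comparison_dom_nonempty: "comparison_dom x B D a b c d \<noteq> {}"
proof -
  let ?E = "{t. poly (B * D) t \<noteq> 0}"
  let ?F = "{t. c * t + d \<noteq> 0 \<and> moebius a b c d t \<in> ?E}"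
  have E: "finite (- ?E)"
    using poly_roots_finite[OF BD] by (simp add: Compl_eq)
  define R where "R = - (moebius_dom x a b c d \<inter> ?E \<inter> ?F)"
  have R: "finite R"
    using E finite_moebius_preimage[OF det E] finite_moebius_dom[OF det, of x]
    by (simp add: R_def)
  have eq: "comparison_dom x B D a b c d = torsion_dom x - R"
    by (auto simp: comparison_dom_def R_def moebius_dom_def)
  show "open (comparison_dom x B D a b c d)"
    unfolding eq by (intro open_Diff open_torsion_dom finite_imp_closed R)
  have "torsion_dom x \<noteq> {}"
    using is_line_curve[OF proper] line by (auto simp: torsion_dom_def)
  then have "infinite (torsion_dom x)"
    using infinite_open_real[OF open_torsion_dom] by blast
  then show "comparison_dom x B D a b c d \<noteq> {}"
    unfolding eq using R by (metis Diff_eq_empty_iff finite_subset)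
qed

section \<open>Symmetries and changes of parameter\<close>

lemma inverse_rigid_motion:
  assumes "orthogonal_matrix Q"
  shows "transpose Q *v (Q *v p + b) + - (transpose Q *v b) = (p :: real ^ 'n)"
    and "Q *v (transpose Q *v p + - (transpose Q *v b)) + b = p"
  using assms by (simp_all add: orthogonal_matrix_def matrix_vector_right_distrib
      matrix_vector_mult_diff_distrib matrix_vector_mul_assoc del: transpose_matrix_vector)

text \<open>The matrix \<open>Q\<close> fixes \<open>u = x'(t)\<close> and \<open>v = x''(t)\<close> at a regular parameter \<open>t\<close>, and takes \<open>u \<times> v\<close> to \<open>det Q\<close> times itself. If
  \<open>det Q = 1\<close>, then \<open>Q\<close> fixes a basis. If \<open>det Q = -1\<close>, then the displacements from \<open>x(t)\<close> to the points of the
  curve, being fixed by \<open>Q\<close>, are orthogonal to \<open>u \<times> v\<close>, so the curve is planar.\<close>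

lemma rigid_motion_fixing_curve:
  assumes proper: "proper_parametrization x" and line: "\<not> is_line (curve x)"
    and Q: "orthogonal_matrix Q" and fix_curve: "\<And>p. p \<in> curve x \<Longrightarrow> Q *v p + b = p"
    and *: "det Q = 1 \<or> \<not> coplanar (curve x)"
  shows "Q *v p + b = p"
proof -
  note X = rational_curve_rf_map[of x] and dom = open_rf_dom[of x]
  obtain t where t: "t \<in> rf_dom x" and nz: "vderiv (rf_map x) t \<times> vderiv (vderiv (rf_map x)) t \<noteq> 0"
    using is_line_curve[OF proper] line by blast
  define u v where "u = vderiv (rf_map x) t" and "v = vderiv (vderiv (rf_map x)) t"
  have X_eq: "Q *v rf_map x t + b = rf_map x t" if "t \<in> rf_dom x" for t
    using fix_curve rf_map_in_curve that by blast
  have 1: "Q *v vderiv (rf_map x) t = vderiv (rf_map x) t" if "t \<in> rf_dom x" for t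
    unfolding vderiv_affine[OF rational_curve_vderiv(1)[OF X dom that], of Q b, symmetric]
    by (rule vderiv_cong[OF dom _ that]) (rule X_eq)
  have "Q *v vderiv (vderiv (rf_map x)) t = vderiv (vderiv (rf_map x)) t"
    unfolding vderiv_affine[OF rational_curve_vderiv(1)[OF
          rational_curve_vderiv(2)[OF X dom] dom t], of Q 0, symmetric]
    by (rule vderiv_cong[OF dom _ t]) (simp add: 1)
  then have Quv: "Q *v u = u" "Q *v v = v"
    using 1[OF t] by (simp_all add: u_def v_def)
  let ?X = "rf_map x"
  define T B where "T = tangent ?X t" and "B = binormal ?X t"
  note frame = norm_tangent[OF nz, folded T_def] norm_binormal[OF nz, folded B_def]
    tangent_binormal[OF nz, folded T_def B_def]
  note expand = orthonormal_frame_expansion[OF frame]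
  have QT: "Q *v T = T"
    using Quv by (simp add: T_def tangent_def sgn_div_norm matrix_vector_mult_scaleR u_def)
  have Quxv: "u \<times> v = det Q *\<^sub>R (Q *v (u \<times> v))"
    using cross_orthogonal_matrix[OF Q, of u v] Quv by simp
  consider "det Q = 1" | "det Q = -1" "\<not> coplanar (curve x)"
    using * det_orthogonal_matrix[OF Q] by blast
  then show ?thesis
  proof cases
    case 1
    then have QB: "Q *v B = B"
      using Quxv by (simp add: B_def binormal_def sgn_div_norm matrix_vector_mult_scaleR u_def v_def)
    then have QN: "Q *v (B \<times> T) = B \<times> T"
      using cross_orthogonal_matrix[OF Q, of B T] QT 1 by simp
    have "Q *v q = q" for q
      by (subst (1 2) expand[of q, symmetric])
        (simp add: matrix_vector_right_distrib matrix_vector_mult_scaleR QT QB QN)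
    then show ?thesis
      using X_eq[OF t] by simp
  next
    case 2
    then have QB: "Q *v B = - B"
      using Quxv by (simp add: B_def binormal_def sgn_div_norm matrix_vector_mult_scaleR u_def v_def)
        (metis add.inverse_inverse scaleR_minus_right)
    define p0 where "p0 = rf_map x t"
    have "q \<in> affine hull {p0, p0 + T, p0 + B \<times> T}" if q: "q \<in> curve x" for q
    proof -
      define e where "e = q - p0"
      have "Q *v e = e"
        using fix_curve[OF q] X_eq[OF t]
        by (simp add: e_def p0_def matrix_vector_mult_diff_distrib) (metis add_diff_cancel_right)
      then have "B \<bullet> e = - (B \<bullet> e)"
        using inner_orthogonal_matrix_mult[OF Q, of B e] QB by simp
      then have "B \<bullet> e = 0" by simp
      then have "e = (T \<bullet> e) *\<^sub>R T + ((B \<times> T) \<bullet> e) *\<^sub>R (B \<times> T)"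
        using expand[of e] by simp
      then have "q = p0 + (T \<bullet> e) *\<^sub>R T + ((B \<times> T) \<bullet> e) *\<^sub>R (B \<times> T)"
        by (simp add: e_def algebra_simps)
      also have "\<dots> = (1 - (T \<bullet> e) - ((B \<times> T) \<bullet> e)) *\<^sub>R p0 + (T \<bullet> e) *\<^sub>R (p0 + T)
          + ((B \<times> T) \<bullet> e) *\<^sub>R (p0 + B \<times> T)"
        by (simp add: algebra_simps)
      finally show ?thesis
        unfolding affine_hull_3 mem_Collect_eq
        by (intro exI[of _ "1 - (T \<bullet> e) - ((B \<times> T) \<bullet> e)"] exI[of _ "T \<bullet> e"]
            exI[of _ "(B \<times> T) \<bullet> e"]) (simp del: vector_add_component)
    qed
    then have "coplanar (curve x)"
      unfolding coplanar_def by blast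
    with 2 show ?thesis by blast
  qed
qed

text \<open>Numerator and denominator of \<open>\<phi>\<close> have degree at most one (\<open>left_invertible_rational_degree\<close>), and the
  determinant is nonzero because \<open>\<phi>\<close> is injective on an infinite set.\<close>

lemma left_invertible_rational_is_moebius:
  assumes phi: "rational_on S \<phi>" and psi: "rational_on T \<psi>" and S: "infinite S"
    and inv: "\<And>t. t \<in> S \<Longrightarrow> \<phi> t \<in> T \<and> \<psi> (\<phi> t) = t"
  shows "\<exists>a b c d. a * d - b * c \<noteq> 0 \<and> (\<forall>t\<in>S. c * t + d \<noteq> 0 \<and> \<phi> t = moebius a b c d t)"
proof -
  have "S \<noteq> {}" using S by auto
  then have "T \<noteq> {}" using inv by blast
  obtain P Q where PQ: "coprime P Q"
    and phi_eq: "\<forall>t\<in>S. poly Q t \<noteq> 0 \<and> \<phi> t = poly P t / poly Q t"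
    by (rule rational_on_reduced[OF phi \<open>S \<noteq> {}\<close>])
  obtain R W where RW: "coprime R W"
    and psi_eq: "\<forall>t\<in>T. poly W t \<noteq> 0 \<and> \<psi> t = poly R t / poly W t"
    by (rule rational_on_reduced[OF psi \<open>T \<noteq> {}\<close>])
  have "poly Q t \<noteq> 0 \<and> poly W (poly P t / poly Q t) \<noteq> 0
      \<and> poly R (poly P t / poly Q t) / poly W (poly P t / poly Q t) = t" if t: "t \<in> S" for t
    using bspec[OF phi_eq t] bspec[OF psi_eq, of "\<phi> t"] inv[OF t] by metis
  from left_invertible_rational_degree[OF PQ RW S this]
  have deg: "degree P \<le> 1" "degree Q \<le> 1" by auto
  have linear: "poly p t = coeff p 1 * t + coeff p 0" if "degree p \<le> 1" for p :: "real poly" and t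
  proof -
    have "p = [:coeff p 0, coeff p 1:]"
      by (rule poly_eqI) (use that in \<open>auto simp: coeff_pCons coeff_eq_0 split: nat.split\<close>)
    then show ?thesis
      by (metis add.commute mult.commute mult_zero_right add.right_neutral poly_0 poly_pCons)
  qed
  define a b c d where "a = coeff P 1" and "b = coeff P 0" and "c = coeff Q 1" and "d = coeff Q 0"
  have mu: "c * t + d \<noteq> 0 \<and> \<phi> t = moebius a b c d t" if "t \<in> S" for t
    using bspec[OF phi_eq that] by (simp add: linear[OF deg(1)] linear[OF deg(2)] moebius_def a_def b_def c_def d_def)
  have "a * d - b * c \<noteq> 0"
  proof
    assume zero: "a * d - b * c = 0"
    obtain t where t: "t \<in> S" using S by (metis finite.emptyI ex_in_conv)
    have "infinite (S - {t})" using S by simp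
    then obtain s where s: "s \<in> S" "s \<noteq> t" by (metis finite.emptyI ex_in_conv DiffE insertCI)
    have "(a * s + b) * (c * t + d) - (a * t + b) * (c * s + d) = (a * d - b * c) * (s - t)"
      by (simp add: algebra_simps)
    then have "moebius a b c d s = moebius a b c d t"
      using mu[OF s(1)] mu[OF t] zero by (simp add: moebius_def frac_eq_eq)
    then have "\<phi> s = \<phi> t"
      using mu[OF s(1)] mu[OF t] by simp
    then show False
      using inv[OF s(1)] inv[OF t] s(2) by metis
  qed
  then show ?thesis using mu by blast
qed

text \<open>With \<open>g / h\<close> inverse to the parametrization \<open>X\<close>, the map \<open>\<phi> = (g / h) \<circ> f \<circ> X\<close> is rational, and
  \<open>\<psi> = (g / h) \<circ> f\<^sup>-\<^sup>1 \<circ> X\<close> is a left inverse: \<open>X (\<phi> t) = f (X t)\<close>, so \<open>\<psi> (\<phi> t) = (g / h) (X t) = t\<close>.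
  Injectivity of \<open>f \<circ> X\<close> ensures that only finitely many parameters are lost to the exceptional points of
  the curve.\<close>

lemma symmetry_induces_moebius:
  assumes proper: "proper_parametrization x" and Q: "orthogonal_matrix Q"
    and sym: "\<And>p. p \<in> curve x \<Longrightarrow> Q *v p + b \<in> curve x"
  shows "\<exists>a' b' c d. a' * d - b' * c \<noteq> 0 \<and>
    (\<forall>t\<in>moebius_dom x a' b' c d. rf_map x (moebius a' b' c d t) = Q *v rf_map x t + b)"
proof -
  let ?X = "rf_map x"
  define f where "f p = Q *v p + b" for p
  define f' where "f' p = transpose Q *v p + - (transpose Q *v b)" for p
  have f': "f' (f p) = p" for p
    unfolding f_def f'_def by (rule inverse_rigid_motion(1)[OF Q])
  obtain g h D where gh: "real_polynomial_function g" "real_polynomial_function h"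
    and D: "D \<subseteq> rf_dom x" "finite (- D)"
    and inv: "\<forall>t\<in>D. h (?X t) \<noteq> 0 \<and> g (?X t) / h (?X t) = t"
    and inj: "inj_on ?X D"
    and bad: "finite {p \<in> curve x. \<not> (h p \<noteq> 0 \<and> g p / h p \<in> rf_dom x \<and> ?X (g p / h p) = p)}"
      (is "finite ?bad")
    by (rule proper_parametrizationE[OF proper])
  define S where "S = {t \<in> D. f (?X t) \<notin> ?bad}"
  have "inj_on (\<lambda>t. f (?X t)) D"
    using inj f' by (metis (mono_tags, lifting) inj_on_def)
  then have "finite ((\<lambda>t. f (?X t)) -` ?bad \<inter> D)"
    using bad by (intro finite_vimage_IntI)
  moreover have "- S = - D \<union> ((\<lambda>t. f (?X t)) -` ?bad \<inter> D)"
    by (auto simp: S_def)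
  ultimately have "finite (- S)"
    using D(2) by simp
  then have S: "infinite S"
    by (rule infinite_cofinite_real)
  define \<phi> where "\<phi> t = g (f (?X t)) / h (f (?X t))" for t
  define \<psi> where "\<psi> s = g (f' (?X s)) / h (f' (?X s))" for s
  define T where "T = {s \<in> rf_dom x. h (f' (?X s)) \<noteq> 0}"
  have phi: "h (f (?X t)) \<noteq> 0" "\<phi> t \<in> rf_dom x" "?X (\<phi> t) = f (?X t)" if t: "t \<in> S" for t
  proof -
    have "f (?X t) \<in> curve x"
      using t D(1) rf_map_in_curve sym by (auto simp: S_def f_def)
    then show "h (f (?X t)) \<noteq> 0" "\<phi> t \<in> rf_dom x" "?X (\<phi> t) = f (?X t)"
      using t by (auto simp: S_def \<phi>_def)
  qed
  have inv_phi: "\<phi> t \<in> T \<and> \<psi> (\<phi> t) = t" if t: "t \<in> S" for t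
    using phi[OF t] bspec[OF inv, of t] t by (simp add: T_def \<psi>_def f' S_def)
  have "S \<subseteq> rf_dom x" "T \<subseteq> rf_dom x"
    using D(1) by (auto simp: S_def T_def)
  moreover have "rational_curve U (\<lambda>t. M *v ?X t + q)" if "U \<subseteq> rf_dom x" for U M q
    by (rule rational_curve_affine[OF rational_curve_subset[OF rational_curve_rf_map that]])
  ultimately have rS: "rational_curve S (\<lambda>t. f (?X t))" and rT: "rational_curve T (\<lambda>t. f' (?X t))"
    unfolding f_def f'_def by blast+
  note rational_on_f = rational_on_real_polynomial_function[OF gh(1) rS]
    rational_on_real_polynomial_function[OF gh(2) rS]
  note rational_on_f' = rational_on_real_polynomial_function[OF gh(1) rT]
    rational_on_real_polynomial_function[OF gh(2) rT]
  have "rational_on S \<phi>"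
    unfolding \<phi>_def using phi(1) by (rule rational_on_divide[OF rational_on_f])
  moreover have "rational_on T \<psi>"
    unfolding \<psi>_def by (rule rational_on_divide[OF rational_on_f']) (simp add: T_def)
  ultimately obtain a' b' c d where det: "a' * d - b' * c \<noteq> 0"
    and mu: "\<And>t. t \<in> S \<Longrightarrow> c * t + d \<noteq> 0 \<and> \<phi> t = moebius a' b' c d t"
    using left_invertible_rational_is_moebius[OF _ _ S inv_phi] by blast
  have "?X (moebius a' b' c d t) = f (?X t)" if t: "t \<in> moebius_dom x a' b' c d" for t
  proof (rule rational_curve_eqI[OF rational_curve_moebius[OF det] _ _ t])
    show "rational_curve (moebius_dom x a' b' c d) (\<lambda>t. f (?X t))"
      unfolding f_def by (intro rational_curve_affine rational_curve_subset[OF rational_curve_rf_map])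
        (auto simp: moebius_dom_def)
    have "S \<subseteq> {t \<in> moebius_dom x a' b' c d. ?X (moebius a' b' c d t) = f (?X t)}"
      using \<open>S \<subseteq> rf_dom x\<close> mu phi by (fastforce simp: moebius_dom_def)
    then show "infinite {t \<in> moebius_dom x a' b' c d. ?X (moebius a' b' c d t) = f (?X t)}"
      using S infinite_super by blast
  qed
  then show ?thesis
    using det unfolding f_def by blast
qed

lemma same_speed_iff:
  "same_speed x a b c d \<longleftrightarrow>
     (\<forall>t\<in>moebius_dom x a b c d. speed (rf_map x) t = speed (\<lambda>t. rf_map x (moebius a b c d t)) t)"
  by (simp add: same_speed_def moebius_dom_def o_def)

lemma moebius_eq_identity:
  assumes "infinite {t. c * t + d \<noteq> 0 \<and> moebius a b c d t = t}" "c * t + d \<noteq> 0"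
  shows "moebius a b c d t = t"
  using assms rational_on_eqI[OF rational_on_moebius rational_on_ident, of "{t. c * t + d \<noteq> 0}" c d a b t]
  by simp

text \<open>The reparametrization that the symmetry induces has the required properties because the invariants of
  \<open>X \<circ> \<mu>\<close> can be computed in two ways: as those of a reparametrization, and as those of the moved
  curve \<open>f \<circ> X\<close>.\<close>

lemma symmetry_imp_moebius_criterion:
  assumes proper: "proper_parametrization x" and line: "\<not> is_line (curve x)"
    and AB: "is_reduced_fraction A B (\<lambda>t. (curvature (rf_map x) t)\<^sup>2) (curvature_dom x)"
    and CD: "is_reduced_fraction C D (torsion (rf_map x)) (torsion_dom x)"
    and sigma: "\<sigma> = 1 \<or> \<sigma> = -1"
    and sym: "is_symmetry \<sigma> (curve x) f" and p: "p \<in> curve x" "f p \<noteq> p"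
  shows "moebius_criterion x (G_poly \<sigma> A B C D)"
proof -
  obtain Q v where Q: "orthogonal_matrix Q" "det Q = \<sigma>" and f: "f = (\<lambda>p. Q *v p + v)"
    and fC: "f ` curve x = curve x"
    using sym unfolding is_symmetry_def by blast
  have "Q *v p + v \<in> curve x" if "p \<in> curve x" for p
    using fC that unfolding f by blast
  then obtain a b c d where det: "a * d - b * c \<noteq> 0"
    and conj: "\<And>t. t \<in> moebius_dom x a b c d \<Longrightarrow> rf_map x (moebius a b c d t) = Q *v rf_map x t + v"
    using symmetry_induces_moebius[OF proper Q(1)] by blast
  let ?X = "rf_map x" and ?\<mu> = "moebius a b c d" and ?S = "moebius_dom x a b c d"
  define y where "y t = ?X (?\<mu> t)" for t
  note open_S = open_moebius_dom[OF det, of x]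
  have X: "rational_curve ?S ?X"
    by (rule rational_curve_subset[OF rational_curve_rf_map]) (auto simp: moebius_dom_def)
  have y: "y t = Q *v ?X t + v" if "t \<in> ?S" for t
    unfolding y_def by (rule conj[OF that])
  have inv: "speed y t = speed ?X t" "curvature y t = curvature ?X t"
      "torsion y t = \<sigma> * torsion ?X t" if t: "t \<in> ?S" for t
    using invariants_cong[OF open_S y t] speed_rigid_motion[OF X open_S Q(1) t]
      curvature_rigid_motion[OF X open_S Q(1) t] torsion_rigid_motion[OF X open_S Q(1) t] Q(2)
    by simp_all
  have "same_speed x a b c d"
    unfolding same_speed_iff using inv(1) by (simp add: y_def[abs_def])
  moreover have "nontrivial_moebius a b c d"
  proof (rule ccontr)
    assume "\<not> ?thesis"
    then have triv: "?\<mu> t = t" if "t \<in> ?S" for t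
      using that by (auto simp: nontrivial_moebius_def moebius_dom_def)
    have "?S \<subseteq> {t \<in> rf_dom x. Q *v ?X t + v = ?X t}"
    proof
      fix t assume t: "t \<in> ?S"
      then have "t \<in> rf_dom x" by (simp add: moebius_dom_def)
      then show "t \<in> {t \<in> rf_dom x. Q *v ?X t + v = ?X t}"
        using conj[OF t] triv[OF t] by simp
    qed
    then have "infinite {t \<in> rf_dom x. Q *v ?X t + v = ?X t}"
      using infinite_cofinite_real[OF finite_moebius_dom[OF det, of x]] by (rule infinite_super)
    from affine_map_fixes_curve[OF this p(1)] p(2) show False
      by (simp add: f)
  qed
  moreover have "F_poly a b c d dvd G_poly \<sigma> A B C D"
  proof -
    let ?V = "comparison_dom x B D a b c d"
    have "B * D \<noteq> 0"
      using AB CD by (simp add: is_reduced_fraction_def)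
    then have V: "infinite ?V"
      by (intro infinite_open_real open_comparison_dom comparison_dom_nonempty proper line det)
    have invariants: "t \<in> curvature_dom x" "?\<mu> t \<in> curvature_dom x" "t \<in> torsion_dom x"
        "?\<mu> t \<in> torsion_dom x" "curvature ?X (?\<mu> t) = curvature ?X t"
        "torsion ?X (?\<mu> t) = \<sigma> * torsion ?X t"
      if "t \<in> ?V" for t
    proof -
      have t: "t \<in> torsion_dom x" "t \<in> ?S"
        using that by (auto simp: comparison_dom_def)
      show "curvature ?X (?\<mu> t) = curvature ?X t" "torsion ?X (?\<mu> t) = \<sigma> * torsion ?X t"
        using inv(2,3)[OF t(2)] curvature_moebius[OF det t(2)] torsion_moebius[OF det t(2)]
        by (simp_all add: y_def[abs_def])
      \<comment> \<open>nonzero curvature passes from \<open>t\<close> to \<open>\<mu> t\<close>\<close>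
      then show "t \<in> torsion_dom x" "?\<mu> t \<in> torsion_dom x"
        using t by (auto simp: torsion_dom_eq moebius_dom_def)
      then show "t \<in> curvature_dom x" "?\<mu> t \<in> curvature_dom x"
        using torsion_dom_subset_curvature_dom by auto
    qed
    have root: "c * t + d \<noteq> 0"
        "poly A t * poly B (?\<mu> t) - poly A (?\<mu> t) * poly B t = 0"
        "poly C t * poly D (?\<mu> t) - \<sigma> * poly C (?\<mu> t) * poly D t = 0" if t: "t \<in> ?V" for t
    proof -
      have nz: "poly B t \<noteq> 0" "poly D t \<noteq> 0" "poly B (?\<mu> t) \<noteq> 0" "poly D (?\<mu> t) \<noteq> 0"
        using t by (auto simp: comparison_dom_def)
      show "c * t + d \<noteq> 0"
        using t by (simp add: comparison_dom_def moebius_dom_def)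
      have "poly A t / poly B t = poly A (?\<mu> t) / poly B (?\<mu> t)"
        using is_reduced_fractionD[OF AB invariants(1)[OF t] nz(1)]
          is_reduced_fractionD[OF AB invariants(2)[OF t] nz(3)] invariants(5)[OF t] by simp
      then show "poly A t * poly B (?\<mu> t) - poly A (?\<mu> t) * poly B t = 0"
        using nz by (simp add: frac_eq_eq)
      \<comment> \<open>\<open>\<sigma>\<^sup>2 = 1\<close> moves the sign to the side where \<open>T_poly\<close> has it\<close>
      have "\<sigma> * torsion ?X (?\<mu> t) = torsion ?X t"
        using invariants(6)[OF t] sigma by auto
      then have "\<sigma> * poly C (?\<mu> t) / poly D (?\<mu> t) = poly C t / poly D t"
        using is_reduced_fractionD[OF CD invariants(3)[OF t] nz(2)]
          is_reduced_fractionD[OF CD invariants(4)[OF t] nz(4)] by simp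
      then show "poly C t * poly D (?\<mu> t) - \<sigma> * poly C (?\<mu> t) * poly D t = 0"
        using nz by (simp add: frac_eq_eq)
    qed
    have "F_poly a b c d dvd K_poly A B"
    proof (rule F_poly_dvdI[OF det])
      show "infinite {t. c * t + d \<noteq> 0 \<and> poly (poly (K_poly A B) [:?\<mu> t:]) t = 0}"
        by (rule infinite_super[OF _ V]) (use root in \<open>auto simp: poly_K_poly\<close>)
    qed
    moreover have "F_poly a b c d dvd T_poly \<sigma> C D"
    proof (rule F_poly_dvdI[OF det])
      show "infinite {t. c * t + d \<noteq> 0 \<and> poly (poly (T_poly \<sigma> C D) [:?\<mu> t:]) t = 0}"
        by (rule infinite_super[OF _ V]) (use root in \<open>auto simp: poly_T_poly\<close>)
    qed
    ultimately show ?thesis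
      unfolding G_poly_def by (rule gcd_greatest)
  qed
  ultimately show ?thesis
    using det unfolding moebius_criterion_def by blast
qed

lemma poly_moebius_eq_0_of_dvd:
  assumes "F_poly a b c d dvd H" "c * t + d \<noteq> 0"
  shows "poly (poly H [:moebius a b c d t:]) t = 0"
  using assms F_poly_root[of c t d a b] by (auto elim!: dvdE)

text \<open>The rigidity theorem only compares curves of equal torsion. For \<open>\<sigma> = -1\<close> it is therefore applied to
  \<open>- X\<close>: the point reflection \<open>- id\<close> has determinant \<open>-1\<close> in dimension three and reverses the sign of the
  torsion while preserving speed and curvature. Both signs are treated at once through the matrix
  \<open>\<sigma> I\<close>, whose determinant is \<open>\<sigma>\<^sup>3 = \<sigma>\<close>.\<close>

lemma moebius_criterion_imp_symmetry:
  assumes proper: "proper_parametrization x" and line: "\<not> is_line (curve x)"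
    and AB: "is_reduced_fraction A B (\<lambda>t. (curvature (rf_map x) t)\<^sup>2) (curvature_dom x)"
    and CD: "is_reduced_fraction C D (torsion (rf_map x)) (torsion_dom x)"
    and sigma: "\<sigma> = 1 \<or> \<sigma> = -1"
    and crit: "moebius_criterion x (G_poly \<sigma> A B C D)"
  shows "\<exists>f. is_symmetry \<sigma> (curve x) f \<and> (\<exists>p\<in>curve x. f p \<noteq> p)"
proof -
  obtain a b c d where det: "a * d - b * c \<noteq> 0" and nontrivial: "nontrivial_moebius a b c d"
    and dvd: "F_poly a b c d dvd G_poly \<sigma> A B C D" and speed: "same_speed x a b c d"
    using crit unfolding moebius_criterion_def by blast
  let ?X = "rf_map x" and ?\<mu> = "moebius a b c d" and ?S = "moebius_dom x a b c d"
  let ?V = "comparison_dom x B D a b c d"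
  define y where "y t = ?X (?\<mu> t)" for t
  note open_S = open_moebius_dom[OF det, of x] and fin_S = finite_moebius_dom[OF det, of x]
  have X: "rational_curve ?S ?X"
    by (rule rational_curve_subset[OF rational_curve_rf_map]) (auto simp: moebius_dom_def)
  have y: "rational_curve ?S y"
    unfolding y_def[abs_def] by (rule rational_curve_moebius[OF det])
  have inv: "speed y t = speed ?X t" "curvature y t = curvature ?X t"
      "torsion y t = \<sigma> * torsion ?X t" "t \<in> torsion_dom x" if t: "t \<in> ?V" for t
  proof -
    have t_S: "t \<in> ?S" and tor: "t \<in> torsion_dom x" and ct: "c * t + d \<noteq> 0"
      and nz: "poly B t \<noteq> 0" "poly D t \<noteq> 0" "poly B (?\<mu> t) \<noteq> 0" "poly D (?\<mu> t) \<noteq> 0"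
      using t by (auto simp: comparison_dom_def moebius_dom_def)
    show "t \<in> torsion_dom x" by (rule tor)
    then have cur: "t \<in> curvature_dom x"
      using torsion_dom_subset_curvature_dom by blast
    show sp: "speed y t = speed ?X t"
      using speed t_S by (simp add: same_speed_iff y_def[abs_def])
    \<comment> \<open>equal speeds exclude a singular parameter at \<open>\<mu> t\<close>, so \<open>A / B\<close> represents the squared curvature there\<close>
    have "?\<mu> t \<in> curvature_dom x"
      using sp cur t_S speed_moebius[OF det t_S]
      by (auto simp: curvature_dom_def moebius_dom_def y_def[abs_def] speed_def)
    then have "(curvature ?X (?\<mu> t))\<^sup>2 = poly A (?\<mu> t) / poly B (?\<mu> t)"
      using is_reduced_fractionD[OF AB _ nz(3)] by blast
    also have "\<dots> = poly A t / poly B t"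
      using poly_moebius_eq_0_of_dvd[OF dvd_trans[OF dvd] ct, of "K_poly A B"] nz
      by (simp add: G_poly_def poly_K_poly frac_eq_eq)
    also have "\<dots> = (curvature ?X t)\<^sup>2"
      using is_reduced_fractionD[OF AB cur nz(1)] by simp
    finally have k: "curvature ?X (?\<mu> t) = curvature ?X t"
      by (simp add: curvature_nonneg)
    then show "curvature y t = curvature ?X t"
      using curvature_moebius[OF det t_S] by (simp add: y_def[abs_def])
    have "?\<mu> t \<in> torsion_dom x"
      using k tor t_S by (simp add: torsion_dom_eq moebius_dom_def)
    then have "torsion ?X (?\<mu> t) = poly C (?\<mu> t) / poly D (?\<mu> t)"
      using is_reduced_fractionD[OF CD _ nz(4)] by blast
    moreover have "poly C t / poly D t = \<sigma> * poly C (?\<mu> t) / poly D (?\<mu> t)"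
      using poly_moebius_eq_0_of_dvd[OF dvd_trans[OF dvd] ct, of "T_poly \<sigma> C D"] nz
      by (simp add: G_poly_def poly_T_poly frac_eq_eq)
    moreover have "torsion ?X t = poly C t / poly D t"
      by (rule is_reduced_fractionD[OF CD tor nz(2)])
    ultimately have "torsion ?X (?\<mu> t) = \<sigma> * torsion ?X t"
      using sigma by auto
    then show "torsion y t = \<sigma> * torsion ?X t"
      using torsion_moebius[OF det t_S] by (simp add: y_def[abs_def])
  qed
  have BD: "B * D \<noteq> 0"
    using AB CD by (simp add: is_reduced_fraction_def)
  obtain t0 e where e: "e > 0" "ball t0 e \<subseteq> ?V"
    using open_comparison_dom[OF proper line det BD] comparison_dom_nonempty[OF proper line det BD]
    by (meson ex_in_conv open_contains_ball)
  have J: "ball t0 e \<subseteq> ?S"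
    using e(2) by (auto simp: comparison_dom_def)
  note XJ = rational_curve_subset[OF X J]
  have R: "orthogonal_matrix (mat \<sigma> :: real ^ 3 ^ 3)" "det (mat \<sigma> :: real ^ 3 ^ 3) = \<sigma>"
  proof -
    show "orthogonal_matrix (mat \<sigma> :: real ^ 3 ^ 3)"
      using sigma by (auto simp: orthogonal_matrix_def Finite_Cartesian_Product.transpose_def
          matrix_matrix_mult_def mat_def
          vec_eq_iff sum_3 forall_3)
    show "det (mat \<sigma> :: real ^ 3 ^ 3) = \<sigma>"
      using sigma by (auto simp: det_3 mat_def)
  qed
  define z where "z t = (mat \<sigma> :: real ^ 3 ^ 3) *v ?X t + 0" for t
  have z: "rational_curve (ball t0 e) z"
    unfolding z_def[abs_def] by (rule rational_curve_affine[OF XJ])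
  have inv_z: "speed z t = speed ?X t" "curvature z t = curvature ?X t"
      "torsion z t = \<sigma> * torsion ?X t" if "t \<in> ball t0 e" for t
    using speed_rigid_motion[OF XJ open_ball R(1) that, of 0]
      curvature_rigid_motion[OF XJ open_ball R(1) that, of 0]
      torsion_rigid_motion[OF XJ open_ball R(1) that, of 0] R(2)
    by (simp_all add: z_def[abs_def])
  have regular_z: "vderiv z t \<times> vderiv (vderiv z) t \<noteq> 0"
    and inv_yz: "speed y t = speed z t" "curvature y t = curvature z t" "torsion y t = torsion z t"
    if t: "t \<in> ball t0 e" for t
  proof -
    have t_V: "t \<in> ?V" using e(2) t by blast
    show "vderiv z t \<times> vderiv (vderiv z) t \<noteq> 0"
      using inv_z(2)[OF t] inv(4)[OF t_V] by (simp add: torsion_dom_eq flip: curvature_eq_0_iff)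
    show "speed y t = speed z t" "curvature y t = curvature z t" "torsion y t = torsion z t"
      using inv[OF t_V] inv_z[OF t] by simp_all
  qed
  obtain Q v where Q: "orthogonal_matrix Q" "det Q = 1"
    and yz: "\<forall>t\<in>ball t0 e. y t = Q *v z t + v"
    by (rule rigid_motion_of_equal_invariants[OF open_ball convex_ball _ z
          rational_curve_subset[OF y J] regular_z inv_yz]) (use e(1) in auto)
  define P where "P = Q ** mat \<sigma>"
  define f where "f p = P *v p + v" for p
  have P: "orthogonal_matrix P" "det P = \<sigma>"
    using Q R by (simp_all add: P_def orthogonal_matrix_mul det_mul)
  have conj: "?X (?\<mu> t) = f (?X t)" if t: "t \<in> ?S" for t
  proof -
    have "rational_curve ?S (\<lambda>t. P *v ?X t + v)"
      by (rule rational_curve_affine[OF X])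
    moreover have "ball t0 e \<subseteq> {t \<in> ?S. y t = P *v ?X t + v}"
      using yz J by (auto simp: z_def P_def matrix_vector_mul_assoc)
    then have "infinite {t \<in> ?S. y t = P *v ?X t + v}"
      using e(1) infinite_open_real[of "ball t0 e"] infinite_super by fastforce
    ultimately show ?thesis
      using rational_curve_eqI[OF y _ _ t] by (simp add: y_def f_def)
  qed
  have S_inf: "infinite ?S"
    using fin_S by (rule infinite_cofinite_real)
  have "f p \<in> curve x" if "p \<in> curve x" for p
    unfolding f_def
  proof (rule affine_map_preserves_curve[OF _ that])
    have "?S \<subseteq> {t \<in> rf_dom x. P *v ?X t + v \<in> curve x}"
      using conj rf_map_in_curve unfolding f_def by (fastforce simp: moebius_dom_def)
    then show "infinite {t \<in> rf_dom x. P *v ?X t + v \<in> curve x}"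
      using S_inf by (rule infinite_super)
  qed
  moreover have "\<exists>q\<in>curve x. f q = p" if "p \<in> curve x" for p
  proof
    show "transpose P *v p + - (transpose P *v v) \<in> curve x"
    proof (rule affine_map_preserves_curve[OF _ that])
      have "?\<mu> ` ?S \<subseteq> {t \<in> rf_dom x. transpose P *v ?X t + - (transpose P *v v) \<in> curve x}"
      proof safe
        fix t assume t: "t \<in> ?S"
        then show "?\<mu> t \<in> rf_dom x" by (simp add: moebius_dom_def)
        have "transpose P *v ?X (?\<mu> t) + - (transpose P *v v) = ?X t"
          unfolding conj[OF t] f_def by (rule inverse_rigid_motion(1)[OF P(1)])
        then show "transpose P *v ?X (?\<mu> t) + - (transpose P *v v) \<in> curve x"
          using t rf_map_in_curve[of t x] by (simp add: moebius_dom_def del: transpose_matrix_vector)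
      qed
      moreover have "inj_on ?\<mu> ?S"
        by (rule inj_on_subset[OF inj_on_moebius[OF det]]) (auto simp: moebius_dom_def)
      then have "infinite (?\<mu> ` ?S)"
        using S_inf finite_imageD by blast
      ultimately show "infinite {t \<in> rf_dom x. transpose P *v ?X t + - (transpose P *v v) \<in> curve x}"
        by (rule infinite_super)
    qed
    show "f (transpose P *v p + - (transpose P *v v)) = p"
      unfolding f_def by (rule inverse_rigid_motion(2)[OF P(1)])
  qed
  ultimately have "f ` curve x = curve x"
    by blast
  then have "is_symmetry \<sigma> (curve x) f"
    unfolding is_symmetry_def f_def using P by blast
  moreover have "\<exists>p\<in>curve x. f p \<noteq> p"
  proof (rule ccontr)
    assume "\<not> ?thesis"
    then have fixed: "f p = p" if "p \<in> curve x" for p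
      using that by blast
    obtain E where E: "E \<subseteq> rf_dom x" "finite (- E)" "inj_on ?X E"
      using proper by (rule proper_parametrizationE)
    define U where "U = ?S \<inter> E \<inter> {t. c * t + d \<noteq> 0 \<and> ?\<mu> t \<in> E}"
    have "finite (- U)"
      using fin_S E(2) finite_moebius_preimage[OF det E(2)] by (simp add: U_def)
    then have "infinite U"
      by (rule infinite_cofinite_real)
    moreover have "U \<subseteq> {t. c * t + d \<noteq> 0 \<and> ?\<mu> t = t}"
    proof safe
      fix t assume t: "t \<in> U"
      have "?X (?\<mu> t) = ?X t"
        using conj[of t] fixed[OF rf_map_in_curve[of t x]] t E(1) by (auto simp: U_def)
      then show "?\<mu> t = t"
        using inj_onD[OF E(3)] t by (simp add: U_def)
    qed (simp add: U_def)
    ultimately have "infinite {t. c * t + d \<noteq> 0 \<and> ?\<mu> t = t}"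
      using infinite_super by blast
    then show False
      using nontrivial moebius_eq_identity unfolding nontrivial_moebius_def by blast
  qed
  ultimately show ?thesis by blast
qed

theorem theorem5:
  fixes x :: "(rat poly fract) ^ 3"
    and \<sigma> :: real
    and A B C D :: "real poly"
  assumes "proper_parametrization x"
    and "\<not> is_line (curve x)"
    and "\<not> is_circle (curve x)"
    and "is_reduced_fraction A B (\<lambda>t. (curvature (rf_map x) t)\<^sup>2) (curvature_dom x)"
    and "is_reduced_fraction C D (torsion (rf_map x)) (torsion_dom x)"
    and "\<sigma> = 1 \<or> \<sigma> = -1"
  shows "(\<sigma> = 1 \<or> \<not> coplanar (curve x) \<longrightarrow>
            ((\<exists>f. is_symmetry \<sigma> (curve x) f \<and> f \<noteq> id) \<longleftrightarrow>
             moebius_criterion x (G_poly \<sigma> A B C D))) \<and>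
         ((\<exists>f. is_symmetry \<sigma> (curve x) f \<and> (\<exists>p\<in>curve x. f p \<noteq> p)) \<longleftrightarrow>
             moebius_criterion x (G_poly \<sigma> A B C D))"
proof -
  have iff: "(\<exists>f. is_symmetry \<sigma> (curve x) f \<and> (\<exists>p\<in>curve x. f p \<noteq> p)) \<longleftrightarrow>
      moebius_criterion x (G_poly \<sigma> A B C D)"
    using symmetry_imp_moebius_criterion[OF assms(1,2,4-6)]
      moebius_criterion_imp_symmetry[OF assms(1,2,4-6)] by blast
  have moves: "\<exists>p\<in>curve x. f p \<noteq> p"
    if side: "\<sigma> = 1 \<or> \<not> coplanar (curve x)" and sym: "is_symmetry \<sigma> (curve x) f" and ne: "f \<noteq> id" for f
  proof (rule ccontr)
    assume fixed: "\<not> ?thesis"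
    obtain Q b where Q: "orthogonal_matrix Q" "det Q = \<sigma>" and f: "f = (\<lambda>p. Q *v p + b)"
      using sym unfolding is_symmetry_def by blast
    have "f p = p" for p
      unfolding f
    proof (rule rigid_motion_fixing_curve[OF assms(1,2) Q(1)])
      show "Q *v p + b = p" if "p \<in> curve x" for p
        using fixed that unfolding f by blast
      show "det Q = 1 \<or> \<not> coplanar (curve x)"
        using side Q(2) by simp
    qed
    then show False
      using ne by auto
  qed
  have "(\<exists>f. is_symmetry \<sigma> (curve x) f \<and> f \<noteq> id) \<longleftrightarrow>
      (\<exists>f. is_symmetry \<sigma> (curve x) f \<and> (\<exists>p\<in>curve x. f p \<noteq> p))"
    if "\<sigma> = 1 \<or> \<not> coplanar (curve x)"
    using moves[OF that] by (metis id_apply)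
  with iff show ?thesis by blast
qed

end
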